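(* The irregularity-isolation property $\mathrm{Iso}(p,q)$ (defined in the context) holds in each of the following cases: (i) $q\ge p=1$; (ii) $p=q=2$.
   Context: Regularity constant. For a simplicial complex $K$ (complexes are finite), $$\vartheta_K=\sup_{\sigma\in K}\frac{\mathrm{diameter}(\sigma)\,\mathrm{perimeter}(\sigma)}{B_\sigma}+2\sup_{\sigma\in K}\frac{\mathrm{diameter}(\sigma)}{\mathrm{inradius}(\sigma)},$$ where the suprema are over simplices of dimension $\geq 1$ (and are $0$ if there are none), and for an $l$-simplex $\sigma$, $\mathrm{perimeter}(\sigma)$ is the $(l-1)$-volume of $\partial\sigma$ and $B_\sigma$ is the $l$-volume of a ball of radius $\mathrm{inradius}(\sigma)/2$ in $\mathbb{R}^l$. Property $\mathrm{Iso}(p,q)$. There is a constant $\beta$ such that for every $p$-dimensional simplicial complex $K$ in $\mathbb{R}^q$ there is a constant $\alpha_K$ such that for every $\epsilon>0$ there exist a subdivision $M_\epsilon$ of $K$ and a subcomplex $M_\epsilon'$ of $M_\epsilon$ with: (1) $M_\epsilon\setminus M_\epsilon'\subseteq\{x\in\mathbb{R}^q : \|x-y\|<\epsilon \text{ for some } y \text{ in the } (p-1)\text{-skeleton of } K\}$ (as point sets, i.e. underlying spaces); (2) $\vartheta_{M_\epsilon}\le\alpha_K$; (3) $\vartheta_{M_\epsilon'}\le\beta$. (So $\alpha_K$ does not depend on $\epsilon$, and $\beta$ depends on neither $K$ nor $\epsilon$.) *)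

theory Defs
  imports "HOL-Analysis.Analysis"
begin

text \<open>
  Simplicial complexes are those of \<^theory>\<open>HOL-Analysis.Polytope\<close>: finite sets of
  closed simplices, closed under faces. The empty simplex (of affine dimension \<open>-1\<close>) counts as
  a face, so it belongs to every nonempty complex.
\<close>

section \<open>Volume, perimeter, inradius\<close>

definition orthonormal_frame_of :: "'a::euclidean_space set \<Rightarrow> 'a \<Rightarrow> nat \<Rightarrow> (nat \<Rightarrow> 'a) \<Rightarrow> bool" where
  "orthonormal_frame_of S a k e \<longleftrightarrow>
     (\<forall>i<k. \<forall>j<k. e i \<bullet> e j = (if i = j then 1 else 0)) \<and>
     affine hull S = (\<lambda>t. a + (\<Sum>i<k. t i *\<^sub>R e i)) ` ({..<k} \<rightarrow>\<^sub>E (UNIV :: real set))"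

text \<open>
  The \<open>k\<close>-dimensional volume of a set of affine dimension \<open>k\<close>: its \<open>k\<close>-dimensional Lebesgue
  measure in isometric coordinates on its affine hull. By invariance of Lebesgue measure under
  isometries, the value does not depend on the chosen frame. For \<open>k = 0\<close> this is counting measure.
\<close>

definition flat_volume :: "'a::euclidean_space set \<Rightarrow> real" where
  "flat_volume S = (let k = nat (aff_dim S) in
     SOME v. \<exists>a e. orthonormal_frame_of S a k e \<and>
       v = measure (PiM {..<k} (\<lambda>_. lborel))
             {t \<in> {..<k} \<rightarrow>\<^sub>E UNIV. a + (\<Sum>i<k. t i *\<^sub>R e i) \<in> S})"

text \<open>
  The boundary of an \<open>l\<close>-simplex is the union of its facets, any two of which meet in dimension
  at most \<open>l - 2\<close>; its \<open>(l-1)\<close>-volume is the sum of the volumes of the facets.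
\<close>

definition perimeter :: "'a::euclidean_space set \<Rightarrow> real" where
  "perimeter \<sigma> = (\<Sum>F | F facet_of \<sigma>. flat_volume F)"

definition inradius :: "'a::euclidean_space set \<Rightarrow> real" where
  "inradius \<sigma> = Sup {r. 0 \<le> r \<and> (\<exists>c\<in>\<sigma>. cball c r \<inter> affine hull \<sigma> \<subseteq> \<sigma>)}"

text \<open>\<open>B\<^sub>\<sigma>\<close>: a ball of radius \<open>r\<close> in \<open>l\<close>-space has volume \<open>unit_ball_vol l * r ^ l\<close>.\<close>

definition half_inball_volume :: "'a::euclidean_space set \<Rightarrow> real" where
  "half_inball_volume \<sigma> =
     (let l = nat (aff_dim \<sigma>) in unit_ball_vol (real l) * (inradius \<sigma> / 2) ^ l)"

section \<open>The regularity constant\<close>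

definition positive_simplices :: "'a::euclidean_space set set \<Rightarrow> 'a set set" where
  "positive_simplices K = {\<sigma> \<in> K. 1 \<le> aff_dim \<sigma>}"

definition sup_or_zero :: "('b \<Rightarrow> real) \<Rightarrow> 'b set \<Rightarrow> real" where
  "sup_or_zero f A = (if A = {} then 0 else SUP x\<in>A. f x)"

definition regularity_constant :: "'a::euclidean_space set set \<Rightarrow> real" where
  "regularity_constant K =
     sup_or_zero (\<lambda>\<sigma>. diameter \<sigma> * perimeter \<sigma> / half_inball_volume \<sigma>) (positive_simplices K) +
     2 * sup_or_zero (\<lambda>\<sigma>. diameter \<sigma> / inradius \<sigma>) (positive_simplices K)"

section \<open>Irregularity isolation\<close>

definition simplicial_complex_of_dim :: "nat \<Rightarrow> 'a::euclidean_space set set \<Rightarrow> bool" where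
  "simplicial_complex_of_dim p K \<longleftrightarrow> simplicial_complex K \<and>
     (\<forall>\<sigma>\<in>K. aff_dim \<sigma> \<le> int p) \<and> (\<exists>\<sigma>\<in>K. aff_dim \<sigma> = int p)"

definition skeleton :: "int \<Rightarrow> 'a::euclidean_space set set \<Rightarrow> 'a set set" where
  "skeleton n K = {\<sigma> \<in> K. aff_dim \<sigma> \<le> n}"

definition subdivision_of :: "'a::euclidean_space set set \<Rightarrow> 'a set set \<Rightarrow> bool" where
  "subdivision_of M K \<longleftrightarrow> simplicial_complex M \<and> \<Union>M = \<Union>K \<and> (\<forall>\<sigma>\<in>M. \<exists>\<tau>\<in>K. \<sigma> \<subseteq> \<tau>)"

definition subcomplex_of :: "'a::euclidean_space set set \<Rightarrow> 'a set set \<Rightarrow> bool" where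
  "subcomplex_of L M \<longleftrightarrow> simplicial_complex L \<and> L \<subseteq> M"

text \<open>The second argument represents the ambient space, e.g. \<open>TYPE(real ^ 'q)\<close>.\<close>

definition Iso :: "nat \<Rightarrow> 'a::euclidean_space itself \<Rightarrow> bool" where
  "Iso p (_ :: 'a itself) \<longleftrightarrow>
     (\<exists>\<beta>. \<forall>K :: 'a set set. simplicial_complex_of_dim p K \<longrightarrow>
       (\<exists>\<alpha>. \<forall>\<epsilon>>0. \<exists>M M'. subdivision_of M K \<and> subcomplex_of M' M \<and>
          \<Union>M - \<Union>M' \<subseteq> {x. \<exists>y \<in> \<Union>(skeleton (int p - 1) K). norm (x - y) < \<epsilon>} \<and>
          regularity_constant M \<le> \<alpha> \<and>
          regularity_constant M' \<le> \<beta>))"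

end

theory Submission
  imports Defs
begin

text \<open>
  In dimension one every segment has the same shape constants, so \<open>K\<close> itself works. In the plane the
  subdivision is a Delaunay triangulation. Each edge of \<open>K\<close> is cut at distances \<open>h, 2h, 3h, \<dots>\<close> from
  both of its ends, and at its midpoint; cutting edges with a common vertex at equal distances makes
  the closed disc over each piece free of other cut points, however small the angle between them.
  The cut points are completed to a net: every added point is at distance at least \<open>2h\<close> from all
  others, and every point near \<open>K\<close> is within \<open>2h\<close> of the net. The discs over the pieces remain
  empty, so the pieces are Delaunay edges and the triangulation subdivides \<open>K\<close>; every
  circumradius is at most \<open>2h\<close>. A triangle with circumradius at most \<open>R\<close> and sides at least
  \<open>\<delta> R\<close> has shape bounded in terms of \<open>\<delta>\<close>. Two cut points are at least a multiple of \<open>h\<close> apart that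
  depends only on the angles of \<open>K\<close>, which gives \<open>\<alpha>\<close>. A triangle with a side shorter than \<open>2h\<close> has
  two cut points as vertices, so it lies within \<open>4h\<close> of the edges of \<open>K\<close>; the others make up \<open>M'\<close>
  and have \<open>\<delta> = 1\<close>.
\<close>

section \<open>Segments\<close>

text \<open>Shape control of a Delaunay triangle rests on two lengths only, a lower bound for its
  sides and an upper bound for its circumradius. Both are multiples of \<open>h\<close>, so the
  scale cancels from the regularity constant. What remains is a pure number for \<open>M'\<close>,
  and for \<open>M\<close> the constant \<open>\<kappa>\<close>, which bounds from below the chord
  between the unit directions of two edges at a common vertex. The distance \<open>c\<close> between
  disjoint parts of \<open>K\<close> only limits how large \<open>h\<close> may be.

  An added net point cannot enter the disc over a piece: a piece has length at most 3h/2, so its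
  disc has radius at most 3h/4, while a point at distance at least 2h from an end is at least 5h/4
  away from the centre.

  Cocircular points leave Delaunay cells that are not triangles. Moving the points would take cut
  points off the edges, so it is the heights \<open>x \<bullet> x\<close> of the lift to the
  paraboloid that are perturbed, to \<open>x \<bullet> x + t ^ k x\<close> with small t. Simplices
  with a strictly empty sphere survive this, and every full-dimensional simplex that arises still
  has an empty circumsphere.\<close>

lemma flat_volume_eqI:
  fixes S :: "'a::euclidean_space set"
  assumes "nat (aff_dim S) = k"
    and "orthonormal_frame_of S a0 k e0"
    and "\<And>a e. orthonormal_frame_of S a k e \<Longrightarrow>
       measure (PiM {..<k} (\<lambda>_. lborel))
             {t \<in> {..<k} \<rightarrow>\<^sub>E UNIV. a + (\<Sum>i<k. t i *\<^sub>R e i) \<in> S} = v"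
  shows "flat_volume S = v"
proof -
  let ?P = "\<lambda>v. \<exists>a e. orthonormal_frame_of S a k e \<and>
       v = measure (PiM {..<k} (\<lambda>_. lborel))
             {t \<in> {..<k} \<rightarrow>\<^sub>E UNIV. a + (\<Sum>i<k. t i *\<^sub>R e i) \<in> S}"
  \<comment> \<open>\<open>SOME\<close> chooses among the values of all frames, so one frame has to
    exist and all frames have to agree.\<close>
  have "?P (SOME v. ?P v)"
    by (rule someI_ex) (use assms(2) in blast)
  moreover have "x = v" if "?P x" for x
    using that assms(3) by blast
  ultimately have "(SOME v. ?P v) = v"
    by blast
  then show ?thesis
    by (simp add: flat_volume_def assms(1))
qed

lemma flat_volume_singleton:
  fixes a :: "'a::euclidean_space"
  shows "flat_volume {a} = 1"
proof (rule flat_volume_eqI[where k = 0])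
  show "orthonormal_frame_of {a} a 0 (\<lambda>_. 0)"
    by (simp add: orthonormal_frame_of_def)
next
  fix a' :: 'a and e assume "orthonormal_frame_of {a} a' 0 e"
  then have [simp]: "a' = a"
    by (simp add: orthonormal_frame_of_def)
  \<comment> \<open>The product over the empty index set has a single point, the everywhere
    undefined function, and its mass is 1.\<close>
  have "{t \<in> {..<0::nat} \<rightarrow>\<^sub>E (UNIV :: real set). a' + (\<Sum>i<0. t i *\<^sub>R e i) \<in> {a}} = {\<lambda>_. undefined}"
    by simp
  then show "measure (PiM {..<0::nat} (\<lambda>_. lborel))
      {t \<in> {..<0} \<rightarrow>\<^sub>E UNIV. a' + (\<Sum>i<0. t i *\<^sub>R e i) \<in> {a}} = 1"
    by (simp add: measure_def)
qed simp

lemma mem_closed_segment_line: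
  fixes a e :: "'a::real_vector" and s t u :: real
  assumes "e \<noteq> 0"
  shows "a + u *\<^sub>R e \<in> closed_segment (a + s *\<^sub>R e) (a + t *\<^sub>R e) \<longleftrightarrow> u \<in> closed_segment s t"
proof -
  have "closed_segment (a + s *\<^sub>R e) (a + t *\<^sub>R e) = (+) a ` (\<lambda>r. r *\<^sub>R e) ` closed_segment s t"
    using closed_segment_linear_image[of "\<lambda>r. r *\<^sub>R e" s t]
    by (simp add: closed_segment_translation linear_scaleR_left)
  then show ?thesis
    using assms by auto
qed

text \<open>In every unit frame of the line the segment becomes the interval between the coordinates
  \<open>s\<close> and \<open>t\<close> of its ends. Their difference is the distance, whatever the
  origin and direction of the frame.\<close>

lemma flat_volume_closed_segment:
  fixes a b :: "'a::euclidean_space"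
  assumes "a \<noteq> b"
  shows "flat_volume (closed_segment a b) = dist a b"
proof -
  define u where "u = (b - a) /\<^sub>R norm (b - a)"
  have "norm u = 1"
    using assms by (simp add: u_def)
  then have u: "u \<bullet> u = 1"
    by (simp add: norm_eq_1)
  have b: "b = a + norm (b - a) *\<^sub>R u"
    using assms by (simp add: u_def)
  have line: "{y. \<exists>t \<in> {..<Suc 0} \<rightarrow>\<^sub>E (UNIV::real set). y = a' + t 0 *\<^sub>R e} = range (\<lambda>t. a' + t *\<^sub>R e)"
    for a' e :: 'a
  proof -
    have "\<exists>f \<in> {..<Suc 0} \<rightarrow>\<^sub>E (UNIV::real set). t = f 0" for t
      by (rule bexI[of _ "restrict (\<lambda>_. t) {..<Suc 0}"]) auto
    then show ?thesis
      unfolding image_def by (smt (verit) Collect_cong UNIV_I)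
  qed
  have aff: "affine hull closed_segment a b = affine hull {a, b}"
    by (simp add: segment_convex_hull)
  have frame_iff: "orthonormal_frame_of (closed_segment a b) a' 1 e \<longleftrightarrow>
      e 0 \<bullet> e 0 = 1 \<and> affine hull {a, b} = range (\<lambda>t. a' + t *\<^sub>R e 0)" for a' e
    unfolding orthonormal_frame_of_def aff
    by (simp add: image_def line)
  show ?thesis
  proof (rule flat_volume_eqI[where k = 1])
    have "aff_dim (closed_segment a b) = 1"
      using assms by (metis aff_dim_simplex one_simplex_segment)
    then show "nat (aff_dim (closed_segment a b)) = 1"
      by simp
    have "affine hull {a, b} = range (\<lambda>t. a + t *\<^sub>R u)"
    proof -
      have "range (\<lambda>t. a + t *\<^sub>R (b - a)) = range (\<lambda>t. a + t *\<^sub>R u)"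
      proof (intro equalityI subsetI)
        fix x assume "x \<in> range (\<lambda>t. a + t *\<^sub>R (b - a))"
        then obtain t where "x = a + t *\<^sub>R (b - a)" by auto
        moreover have "b - a = norm (b - a) *\<^sub>R u"
          using b by (simp add: algebra_simps)
        ultimately have "x = a + (t * norm (b - a)) *\<^sub>R u"
          by (metis scaleR_scaleR)
        then show "x \<in> range (\<lambda>t. a + t *\<^sub>R u)" by blast
      next
        fix x assume "x \<in> range (\<lambda>t. a + t *\<^sub>R u)"
        then obtain t where "x = a + t *\<^sub>R u" by auto
        then have "x = a + (t / norm (b - a)) *\<^sub>R (b - a)"
          by (simp add: u_def divide_inverse)
        then show "x \<in> range (\<lambda>t. a + t *\<^sub>R (b - a))" by blast
      qed
      then show ?thesis
        by (auto simp: affine_hull_2_alt)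
    qed
    then show "orthonormal_frame_of (closed_segment a b) a 1 (\<lambda>_. u)"
      using u by (simp only: frame_iff)
  next
    fix a' e assume "orthonormal_frame_of (closed_segment a b) a' 1 e"
    then have e: "e 0 \<bullet> e 0 = 1" and hull: "affine hull {a, b} = range (\<lambda>t. a' + t *\<^sub>R e 0)"
      by (auto simp only: frame_iff)
    have "a \<in> affine hull {a, b}" "b \<in> affine hull {a, b}"
      by (auto simp: hull_inc)
    then obtain s t where s: "a = a' + s *\<^sub>R e 0" and t: "b = a' + t *\<^sub>R e 0"
      unfolding hull by auto
    have e0: "e 0 \<noteq> 0" and ne: "norm (e 0) = 1"
      using e by (auto simp: norm_eq_sqrt_inner)
    have d: "dist a b = \<bar>s - t\<bar>"
      by (simp add: s t dist_norm ne flip: scaleR_diff_left)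
    have "{f \<in> {..<1} \<rightarrow>\<^sub>E UNIV. a' + (\<Sum>i<1. f i *\<^sub>R e i) \<in> closed_segment a b}
        = (\<Pi>\<^sub>E i\<in>{..<1::nat}. closed_segment s t)"
      unfolding s t using mem_closed_segment_line[OF e0]
      by (auto simp: PiE_iff extensional_def)
    moreover have "emeasure (PiM {..<1::nat} (\<lambda>_. lborel)) (\<Pi>\<^sub>E i\<in>{..<1::nat}. closed_segment s t)
        = ennreal \<bar>s - t\<bar>"
    proof -
      interpret finite_product_sigma_finite "\<lambda>_::nat. lborel :: real measure" "{..<1::nat}"
        by unfold_locales auto
      have "closed_segment s t \<in> sets borel"
        by (simp add: borel_closed)
      then show ?thesis
        by (subst measure_times) (auto simp: closed_segment_eq_real_ivl)
    qed
    ultimately show "measure (PiM {..<1} (\<lambda>_. lborel))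
        {f \<in> {..<1} \<rightarrow>\<^sub>E UNIV. a' + (\<Sum>i<1. f i *\<^sub>R e i) \<in> closed_segment a b} = dist a b"
      by (simp add: measure_def d)
  qed
qed

text \<open>Being one of the radii helps only if the supremum is over a bounded set. A ball of
  radius \<open>r\<close> about \<open>c\<close> contains a point at distance exactly
  \<open>r\<close> in the direction of another point of \<open>S\<close>, so \<open>r\<close> is at
  most the diameter. For a single point all radii would qualify, hence the condition on the
  dimension.\<close>

lemma inradius_ge:
  fixes S :: "'a::euclidean_space set"
  assumes "bounded S" "1 \<le> aff_dim S" "0 \<le> r" "c \<in> S" "cball c r \<inter> affine hull S \<subseteq> S"
  shows "r \<le> inradius S"
  unfolding inradius_def
proof (rule cSup_upper)
  show "r \<in> {r. 0 \<le> r \<and> (\<exists>c\<in>S. cball c r \<inter> affine hull S \<subseteq> S)}"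
    using assms by blast
  show "bdd_above {r. 0 \<le> r \<and> (\<exists>c\<in>S. cball c r \<inter> affine hull S \<subseteq> S)}"
  proof (rule bdd_aboveI)
    fix r assume "r \<in> {r. 0 \<le> r \<and> (\<exists>c\<in>S. cball c r \<inter> affine hull S \<subseteq> S)}"
    then obtain c where r: "0 \<le> r" "c \<in> S" "cball c r \<inter> affine hull S \<subseteq> S"
      by blast
    have "\<not> S \<subseteq> {c}"
      using assms(2) aff_dim_subset[of S "{c}"] by auto
    then obtain d where d: "d \<in> S" "d \<noteq> c"
      by blast
    define x where "x = c + (r / norm (d - c)) *\<^sub>R (d - c)"
    have "x \<in> affine hull S"
      unfolding x_def using mem_affine[of "affine hull S" c d "1 - r / norm (d - c)" "r / norm (d - c)"]
        r d by (simp add: hull_inc algebra_simps)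
    moreover have "dist c x = r"
      using r d by (simp add: x_def dist_norm)
    ultimately have "x \<in> S"
      using r by auto
    then show "r \<le> diameter S"
      using diameter_bounded_bound[OF assms(1) \<open>c \<in> S\<close>] \<open>dist c x = r\<close> by metis
  qed
qed

lemma diameter_convex_hull_le:
  fixes S :: "'a::euclidean_space set"
  assumes "finite S" "0 \<le> d" "\<And>x y. \<lbrakk>x \<in> S; y \<in> S\<rbrakk> \<Longrightarrow> dist x y \<le> d"
  shows "diameter (convex hull S) \<le> d"
proof (rule diameter_le)
  fix x y assume "x \<in> convex hull S" "y \<in> convex hull S"
  then obtain u v where "u \<in> S" "v \<in> S" "norm (x - y) \<le> norm (u - v)"
    using simplex_extremal_le_exists[OF assms(1)] by blast
  then show "norm (x - y) \<le> d"
    using assms(3) by (fastforce simp: dist_norm)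
qed (use assms in auto)

text \<open>For length L the inradius is L/2, the boundary consists of two points of volume 1 each,
  and the interval of radius L/4 has length L/2. The quotients are therefore 2L/(L/2) = 4 and
  L/(L/2) = 2.\<close>

lemma simplex_regularity_segment:
  fixes S :: "'a::euclidean_space set"
  assumes "n simplex S" "aff_dim S = 1"
  shows "diameter S * perimeter S / half_inball_volume S \<le> 4" (is ?A)
    and "diameter S / inradius S \<le> 2" (is ?B)
proof -
  obtain C where C: "\<not> affine_dependent C" "int (card C) = 2" "S = convex hull C"
    using assms aff_dim_simplex by (metis add.commute one_add_one simplex_def)
  then have "card C = 2" by simp
  then obtain a b where ab: "C = {a, b}" "a \<noteq> b"
    by (auto simp: card_2_iff)
  have S: "S = closed_segment a b"
    using C ab by (simp add: segment_convex_hull)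
  define L where "L = dist a b"
  have L: "0 < L" using ab by (simp add: L_def)
  have diam: "diameter S \<le> L"
    unfolding C(3) ab(1) L_def by (rule diameter_convex_hull_le) (auto simp: dist_commute)
  have r: "L / 2 \<le> inradius S"
  proof (rule inradius_ge[where c = "midpoint a b"])
    show "bounded S" "1 \<le> aff_dim S" "0 \<le> L / 2" "midpoint a b \<in> S"
      using assms L by (auto simp: S bounded_closed_segment)
    show "cball (midpoint a b) (L / 2) \<inter> affine hull S \<subseteq> S"
    proof
      fix x assume x: "x \<in> cball (midpoint a b) (L / 2) \<inter> affine hull S"
      then obtain t where t: "x = a + t *\<^sub>R (b - a)"
        by (auto simp: S segment_convex_hull affine_hull_2_alt)
      have "midpoint a b - x = (1/2 - t) *\<^sub>R (b - a)"
        by (simp add: t midpoint_def algebra_simps) (simp add: scaleR_2 flip: scaleR_add_left)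
      then have "\<bar>1/2 - t\<bar> * L \<le> 1/2 * L"
        using x by (simp add: dist_norm L_def norm_minus_commute)
      then have "\<bar>1/2 - t\<bar> \<le> 1/2"
        using L by (simp only: mult_le_cancel_right_pos)
      then have "0 \<le> t" "t \<le> 1" by linarith+
      then show "x \<in> S"
        by (auto simp: S t closed_segment_def algebra_simps intro!: exI[of _ t])
    qed
  qed
  have "{F. F facet_of S} = {{a}, {b}}"
    using ab C(1)
    by (auto simp: C(3) facet_of_convex_hull_affine_independent_alt insert_Diff_if)
  then have "perimeter S = 2"
    using ab by (simp add: perimeter_def flat_volume_singleton)
  moreover have "half_inball_volume S = inradius S"
    using assms(2) unit_ball_vol_1 by (simp add: half_inball_volume_def)
  ultimately show ?A ?B
    using r L diam by (auto simp: divide_simps)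
qed

text \<open>The bounds must be nonnegative because both suprema are 0 when no simplex has positive
  dimension.\<close>

lemma regularity_constant_le:
  assumes "0 \<le> A" "0 \<le> B"
    and "\<And>S. \<lbrakk>S \<in> K; 1 \<le> aff_dim S\<rbrakk> \<Longrightarrow> diameter S * perimeter S / half_inball_volume S \<le> A"
    and "\<And>S. \<lbrakk>S \<in> K; 1 \<le> aff_dim S\<rbrakk> \<Longrightarrow> diameter S / inradius S \<le> B"
  shows "regularity_constant K \<le> A + 2 * B"
proof -
  have "sup_or_zero f (positive_simplices K) \<le> D"
    if "0 \<le> D" "\<And>S. \<lbrakk>S \<in> K; 1 \<le> aff_dim S\<rbrakk> \<Longrightarrow> f S \<le> D" for f D
    using that by (auto simp: sup_or_zero_def positive_simplices_def intro!: cSUP_least)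
  then show ?thesis
    unfolding regularity_constant_def using assms by (intro add_mono mult_left_mono) auto
qed

lemma Iso_1: "Iso 1 TYPE('a::euclidean_space)"
  unfolding Iso_def
proof (intro exI allI impI)
  fix K :: "'a set set" and e :: real
  assume K: "simplicial_complex_of_dim 1 K"
  then have sc: "simplicial_complex K"
    by (simp add: simplicial_complex_of_dim_def)
  have "regularity_constant K \<le> 4 + 2 * 2"
  proof (rule regularity_constant_le)
    fix S assume "S \<in> K" "1 \<le> aff_dim S"
    moreover obtain n where "n simplex S"
      using \<open>S \<in> K\<close> sc by (auto simp: simplicial_complex_def)
    moreover have "aff_dim S \<le> 1"
      using K \<open>S \<in> K\<close> by (simp add: simplicial_complex_of_dim_def)
    ultimately show "diameter S * perimeter S / half_inball_volume S \<le> 4"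
      "diameter S / inradius S \<le> 2"
      using simplex_regularity_segment[of n S] by auto
  qed auto
  then show "subdivision_of K K \<and> subcomplex_of K K \<and>
       \<Union>K - \<Union>K \<subseteq> {x. \<exists>y \<in> \<Union>(skeleton (int 1 - 1) K). norm (x - y) < e} \<and>
       regularity_constant K \<le> 8 \<and> regularity_constant K \<le> 8"
    using sc by (auto simp: subdivision_of_def subcomplex_of_def)
qed

section \<open>Triangles\<close>

text \<open>Nonnegativity of the Gram determinant of \<open>u, v, w\<close>, where \<open>w\<close> is a circumcentre of \<open>0, u, v\<close>:
  the inequality \<open>abc \<le> 4 R \<cdot> area\<close> for the triangle.\<close>

lemma gram_circumcenter:
  fixes u v w :: "'a::real_inner"
  defines "G \<equiv> (u \<bullet> u) * (v \<bullet> v) - (u \<bullet> v)\<^sup>2"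
  assumes G: "0 < G" and wu: "w \<bullet> u = (u \<bullet> u) / 2" and wv: "w \<bullet> v = (v \<bullet> v) / 2"
  shows "(u \<bullet> u) * (v \<bullet> v) * ((u - v) \<bullet> (u - v)) \<le> 4 * (w \<bullet> w) * G"
proof -
  \<comment> \<open>By Cramer's rule, \<open>\<alpha>\<close>/G and \<open>\<beta>\<close>/G are the
    coordinates of the projection of \<open>w\<close> to the span of \<open>u\<close> and
    \<open>v\<close>; \<open>z\<close> is G times the component of \<open>w\<close> orthogonal to
    that span.\<close>
  define \<alpha> where "\<alpha> = (w \<bullet> u) * (v \<bullet> v) - (w \<bullet> v) * (u \<bullet> v)"
  define \<beta> where "\<beta> = (w \<bullet> v) * (u \<bullet> u) - (w \<bullet> u) * (u \<bullet> v)"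
  define z where "z = G *\<^sub>R w - \<alpha> *\<^sub>R u - \<beta> *\<^sub>R v"
  have "z \<bullet> u = 0"
    by (simp add: z_def inner_diff_left G_def \<alpha>_def \<beta>_def inner_commute[of v u] algebra_simps power2_eq_square)
  moreover have "z \<bullet> v = 0"
    by (simp add: z_def inner_diff_left G_def \<alpha>_def \<beta>_def inner_commute[of v u] algebra_simps power2_eq_square)
  ultimately have "z \<bullet> z = G * (z \<bullet> w)"
    by (simp add: z_def inner_diff_right)
  then have "0 \<le> z \<bullet> w"
    using G by (metis inner_ge_zero zero_le_mult_iff less_le_not_le)
  also have "z \<bullet> w = G * (w \<bullet> w) - \<alpha> * (w \<bullet> u) - \<beta> * (w \<bullet> v)"
    by (simp add: z_def inner_diff_left inner_commute[of w u] inner_commute[of w v])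
  also have "\<dots> = G * (w \<bullet> w) - (u \<bullet> u) * (v \<bullet> v) * ((u - v) \<bullet> (u - v)) / 4"
    unfolding \<alpha>_def \<beta>_def wu wv
    by (simp add: inner_diff_left inner_diff_right inner_commute[of v u] power2_eq_square field_simps)
  finally show ?thesis by (simp add: mult_ac)
qed

text \<open>Up to the factor \<open>v \<bullet> v\<close>, the left side is the squared distance of
  \<open>s u + t v\<close> from the line spanned by \<open>v\<close>. The difference of the two
  sides is the squared inner product of that vector with \<open>v\<close>.\<close>

lemma gram_coefficient_bound:
  fixes u v :: "'a::real_inner"
  shows "s\<^sup>2 * ((u \<bullet> u) * (v \<bullet> v) - (u \<bullet> v)\<^sup>2) \<le> (norm (s *\<^sub>R u + t *\<^sub>R v))\<^sup>2 * (v \<bullet> v)"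
proof -
  have "(norm (s *\<^sub>R u + t *\<^sub>R v))\<^sup>2 * (v \<bullet> v) - s\<^sup>2 * ((u \<bullet> u) * (v \<bullet> v) - (u \<bullet> v)\<^sup>2)
      = (s * (u \<bullet> v) + t * (v \<bullet> v))\<^sup>2"
    unfolding power2_norm_eq_inner
    by (simp add: inner_add_left inner_add_right inner_commute[of v u] algebra_simps power2_eq_square)
  then show ?thesis
    by (metis diff_ge_0_iff_ge zero_le_power2)
qed

text \<open>Equality in the Cauchy-Schwarz inequality would make the three points collinear.\<close>

lemma gram_pos:
  fixes a b c :: "'a::euclidean_space"
  assumes "\<not> affine_dependent {a, b, c}" "a \<noteq> b" "a \<noteq> c" "b \<noteq> c"
  shows "0 < ((b - a) \<bullet> (b - a)) * ((c - a) \<bullet> (c - a)) - ((b - a) \<bullet> (c - a))\<^sup>2"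
proof -
  have "\<not> collinear {b, a, c}"
    using assms by (simp add: collinear_3_eq_affine_dependent insert_commute)
  then have "\<not> collinear {0, b - a, c - a}"
    by (subst (asm) collinear_3) (auto simp: NO_MATCH_def)
  then have "\<bar>(b - a) \<bullet> (c - a)\<bar> \<noteq> norm (b - a) * norm (c - a)"
    by (simp add: norm_cauchy_schwarz_equal)
  then have "\<bar>(b - a) \<bullet> (c - a)\<bar> < norm (b - a) * norm (c - a)"
    using Cauchy_Schwarz_ineq2[of "b - a" "c - a"] by linarith
  then have "\<bar>(b - a) \<bullet> (c - a)\<bar>\<^sup>2 < (norm (b - a) * norm (c - a))\<^sup>2"
    by (intro power_strict_mono) auto
  then show ?thesis
    by (simp add: power_mult_distrib power2_norm_eq_inner)
qed

lemma perimeter_simplex_2_le: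
  fixes a b c :: "'a::euclidean_space"
  assumes "\<not> affine_dependent {a, b, c}" "a \<noteq> b" "a \<noteq> c" "b \<noteq> c"
  shows "perimeter (convex hull {a, b, c}) \<le> dist a b + dist b c + dist a c"
proof -
  have "{F. F facet_of convex hull {a, b, c}}
      \<subseteq> (\<lambda>x. x) ` {closed_segment b c, closed_segment a c, closed_segment a b}"
    using assms
    by (auto simp: facet_of_convex_hull_affine_independent_alt segment_convex_hull insert_Diff_if)
  moreover have nn: "0 \<le> flat_volume F" if "F \<in> {closed_segment b c, closed_segment a c, closed_segment a b}" for F
    using that assms by (auto simp: flat_volume_closed_segment)
  ultimately have "perimeter (convex hull {a, b, c})
      \<le> sum flat_volume {closed_segment b c, closed_segment a c, closed_segment a b}"
    unfolding perimeter_def by (intro sum_mono2) auto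
  also have "\<dots> = dist a b + dist b c + dist a c"
    using assms by (simp add: flat_volume_closed_segment closed_segment_eq doubleton_eq_iff)
  finally show ?thesis .
qed

text \<open>The ball is centred at the centroid, where all barycentric coordinates are 1/3. Its
  radius is such that the coordinates of \<open>b\<close> and \<open>c\<close> change by at most 1/6
  each; then that of \<open>a\<close> changes by at most 1/3 and all three stay nonnegative.\<close>

lemma inradius_simplex_2_ge:
  fixes a b c z :: "'a::euclidean_space"
  assumes indep: "\<not> affine_dependent {a, b, c}" and ne: "a \<noteq> b" "a \<noteq> c" "b \<noteq> c"
    and R: "0 < R" and \<delta>: "0 < \<delta>"
    and circ: "dist z a = \<rho>" "dist z b = \<rho>" "dist z c = \<rho>" "\<rho> \<le> R"
    and sides: "\<delta> * R \<le> dist a b" "\<delta> * R \<le> dist b c" "\<delta> * R \<le> dist a c"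
  shows "\<delta> ^ 3 * R / 24 \<le> inradius (convex hull {a, b, c})"
proof (rule inradius_ge)
  define u where "u = b - a"
  define v where "v = c - a"
  define G where "G = (u \<bullet> u) * (v \<bullet> v) - (u \<bullet> v)\<^sup>2"
  define g where "g = (1/3) *\<^sub>R a + (1/3) *\<^sub>R b + (1/3) *\<^sub>R c"
  have Gpos: "0 < G"
    unfolding G_def u_def v_def by (rule gram_pos[OF indep ne])
  have w: "(z - a) \<bullet> (x - a) = ((x - a) \<bullet> (x - a)) / 2" if "dist z x = \<rho>" for x
  proof -
    have "(z - a) \<bullet> (z - a) = (z - x) \<bullet> (z - x)"
      using that circ(1) by (simp add: dist_norm flip: power2_norm_eq_inner)
    then show ?thesis
      by (simp add: inner_diff_left inner_diff_right inner_commute algebra_simps)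
  qed
  have sq: "(\<delta> * R)\<^sup>2 \<le> (x - y) \<bullet> (x - y)" if "\<delta> * R \<le> dist x y" for x y :: 'a
    using that R \<delta> by (simp add: dist_norm flip: power2_norm_eq_inner)
  have "(u \<bullet> u) * (v \<bullet> v) * ((u - v) \<bullet> (u - v)) \<le> 4 * ((z - a) \<bullet> (z - a)) * G"
    unfolding G_def
    by (rule gram_circumcenter) (use Gpos w circ in \<open>auto simp: G_def u_def v_def\<close>)
  also have "\<dots> \<le> 4 * R\<^sup>2 * G"
  proof -
    have "(z - a) \<bullet> (z - a) \<le> R\<^sup>2"
      using circ by (simp add: dist_norm flip: power2_norm_eq_inner) (metis norm_ge_zero power_mono)
    then show ?thesis
      using Gpos by (intro mult_right_mono) auto
  qed
  finally have "(u \<bullet> u) * (v \<bullet> v) * ((u - v) \<bullet> (u - v)) \<le> 4 * R\<^sup>2 * G" .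
  moreover have "(\<delta> * R)\<^sup>2 * (\<delta> * R)\<^sup>2 * (\<delta> * R)\<^sup>2 \<le> (u \<bullet> u) * (v \<bullet> v) * ((u - v) \<bullet> (u - v))"
    using sq[of b a] sq[of c a] sq[of b c] sides
    by (intro mult_mono) (auto simp: u_def v_def dist_commute)
  \<comment> \<open>The product of the squared sides is at least the sixth power of
    \<open>\<delta> * R\<close> and, by the circumradius inequality, at most 4 R^2 G.\<close>
  ultimately have "R\<^sup>2 * (\<delta> ^ 6 * R ^ 4 / 4) \<le> R\<^sup>2 * G"
    by (simp add: power_mult_distrib algebra_simps flip: power_add)
  then have G: "\<delta> ^ 6 * R ^ 4 / 4 \<le> G"
    using R by (simp only: mult_le_cancel_left_pos zero_less_power)
  have len: "x \<bullet> x \<le> 4 * R\<^sup>2" if "x = y - a" "dist z y = \<rho>" for x y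
  proof -
    have "norm x \<le> 2 * R"
      using dist_triangle2[of y a z] that circ by (simp add: dist_norm norm_minus_commute)
    then have "(norm x)\<^sup>2 \<le> (2 * R)\<^sup>2"
      by (intro power_mono) auto
    then show ?thesis
      by (simp add: power2_norm_eq_inner)
  qed
  show "bounded (convex hull {a, b, c})"
    by (simp add: bounded_convex_hull)
  have "aff_dim {a, b, c} = 2"
    using aff_dim_affine_independent[OF indep] ne by simp
  then show "1 \<le> aff_dim (convex hull {a, b, c})"
    by (simp add: aff_dim_convex_hull)
  show "0 \<le> \<delta> ^ 3 * R / 24"
    using R \<delta> by simp
  show "g \<in> convex hull {a, b, c}"
    unfolding convex_hull_3 g_def by force
  show "cball g (\<delta> ^ 3 * R / 24) \<inter> affine hull (convex hull {a, b, c}) \<subseteq> convex hull {a, b, c}"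
  proof
    fix x assume x: "x \<in> cball g (\<delta> ^ 3 * R / 24) \<inter> affine hull (convex hull {a, b, c})"
    then obtain \<alpha> \<beta> \<gamma> where c: "x = \<alpha> *\<^sub>R a + \<beta> *\<^sub>R b + \<gamma> *\<^sub>R c" "\<alpha> + \<beta> + \<gamma> = 1"
      by (auto simp: affine_hull_convex_hull affine_hull_3)
    define s where "s = \<beta> - 1/3"
    define t where "t = \<gamma> - 1/3"
    have \<alpha>: "\<alpha> = 1/3 - s - t" "\<beta> = 1/3 + s" "\<gamma> = 1/3 + t"
      using c by (auto simp: s_def t_def)
    have "x - g = s *\<^sub>R u + t *\<^sub>R v"
      by (simp add: c(1) \<alpha> g_def u_def v_def algebra_simps)
    moreover have "norm (x - g) \<le> \<delta> ^ 3 * R / 24"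
      using x by (simp add: dist_norm norm_minus_commute)
    ultimately have n: "norm (s *\<^sub>R u + t *\<^sub>R v) \<le> \<delta> ^ 3 * R / 24"
      by simp
    \<comment> \<open>The 24 comes from here: G is at least \<delta>^6 R^4 / 4 and a side is at most
      2R, so a displacement of \<delta>^3 R / 24 moves a coordinate by at most 1/6. By symmetry the
      fact is applied to both \<open>s\<close> and \<open>t\<close>.\<close>
    have key: "\<bar>s\<bar> \<le> 1/6"
      if "norm (s *\<^sub>R u + t *\<^sub>R v) \<le> \<delta> ^ 3 * R / 24"
        and "G = (u \<bullet> u) * (v \<bullet> v) - (u \<bullet> v)\<^sup>2" "v \<bullet> v \<le> 4 * R\<^sup>2" for s t u v
    proof -
      have "s\<^sup>2 * (\<delta> ^ 6 * R ^ 4 / 4) \<le> s\<^sup>2 * G"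
        using G by (intro mult_left_mono) auto
      also have "\<dots> \<le> (norm (s *\<^sub>R u + t *\<^sub>R v))\<^sup>2 * (v \<bullet> v)"
        unfolding that by (rule gram_coefficient_bound)
      also have "\<dots> \<le> (\<delta> ^ 3 * R / 24)\<^sup>2 * (4 * R\<^sup>2)"
        using that by (intro mult_mono power_mono) auto
      also have "\<dots> = (1/6)\<^sup>2 * (\<delta> ^ 6 * R ^ 4 / 4)"
        by (simp add: power_mult_distrib power_divide flip: power_mult power_add)
      finally have "s\<^sup>2 \<le> (1/6)\<^sup>2"
        using R \<delta> by (simp only: mult_le_cancel_right_pos zero_less_power mult_pos_pos divide_pos_pos zero_less_numeral)
      then show ?thesis
        by (metis abs_of_nonneg abs_le_square_iff zero_le_divide_1_iff zero_le_numeral)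
    qed
    have "\<bar>s\<bar> \<le> 1/6"
      by (rule key[OF n G_def]) (rule len[OF v_def circ(3)])
    moreover have "\<bar>t\<bar> \<le> 1/6"
    proof (rule key)
      show "norm (t *\<^sub>R v + s *\<^sub>R u) \<le> \<delta> ^ 3 * R / 24"
        using n by (simp add: add.commute)
      show "G = (v \<bullet> v) * (u \<bullet> u) - (v \<bullet> u)\<^sup>2"
        by (simp add: G_def inner_commute)
      show "u \<bullet> u \<le> 4 * R\<^sup>2"
        by (rule len[OF u_def circ(2)])
    qed
    ultimately have "0 \<le> \<alpha>" "0 \<le> \<beta>" "0 \<le> \<gamma>"
      using \<alpha> by linarith+
    then show "x \<in> convex hull {a, b, c}"
      using c by (auto simp: convex_hull_3)
  qed
qed

text \<open>The diameter is at most 2R, the perimeter at most 6R and the inradius at least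
  \<delta>^3 R / 24. This gives 2 * 24 = 48 and 2 * 6 * 48^2 = 27648, and R cancels.\<close>

lemma simplex_regularity_triangle:
  fixes S :: "'a::euclidean_space set"
  assumes indep: "\<not> affine_dependent Y" and card: "card Y = 3" and S: "S = convex hull Y"
    and R: "0 < R" and \<delta>: "0 < \<delta>"
    and circ: "\<And>y. y \<in> Y \<Longrightarrow> dist z y = \<rho>" "\<rho> \<le> R"
    and sides: "\<And>x y. \<lbrakk>x \<in> Y; y \<in> Y; x \<noteq> y\<rbrakk> \<Longrightarrow> \<delta> * R \<le> dist x y"
  shows "diameter S * perimeter S / half_inball_volume S \<le> 27648 / (pi * \<delta> ^ 6)" (is ?A)
    and "diameter S / inradius S \<le> 48 / \<delta> ^ 3" (is ?B)
proof -
  obtain a b c where Y: "Y = {a, b, c}" and ne: "a \<noteq> b" "a \<noteq> c" "b \<noteq> c"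
    using card by (auto simp: card_3_iff)
  define r where "r = inradius S"
  have r: "\<delta> ^ 3 * R / 24 \<le> r"
    unfolding r_def S Y
    by (rule inradius_simplex_2_ge) (use indep ne R \<delta> circ sides in \<open>auto simp: Y\<close>)
  have "0 < \<delta> ^ 3 * R / 24"
    using R \<delta> by simp
  then have rpos: "0 < r"
    using r by linarith
  have dist: "dist x y \<le> 2 * R" if "x \<in> Y" "y \<in> Y" for x y
    using dist_triangle2[of x y z] circ that by (metis add_mono dist_commute mult_2 order_trans)
  have diam: "diameter S \<le> 2 * R"
    unfolding S using R dist by (intro diameter_convex_hull_le) (auto simp: Y)
  have diam0: "0 \<le> diameter S"
    unfolding S by (intro diameter_ge_0 bounded_convex_hull) (simp add: Y)
  have perim: "perimeter S \<le> 6 * R"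
    using perimeter_simplex_2_le[of a b c] indep ne dist[of a b] dist[of b c] dist[of a c]
    by (simp add: S Y)
  have "aff_dim S = 2"
    using aff_dim_affine_independent[OF indep] card by (simp add: S aff_dim_convex_hull)
  then have vol: "half_inball_volume S = pi * (r / 2)\<^sup>2"
    by (simp add: half_inball_volume_def r_def unit_ball_vol_2)
  have "diameter S / r \<le> 2 * R / (\<delta> ^ 3 * R / 24)"
    using diam diam0 r R \<delta> by (intro frac_le) auto
  also have "\<dots> = 48 / \<delta> ^ 3"
    using R by simp
  finally show ?B by (simp add: r_def)
  have "diameter S * perimeter S / half_inball_volume S \<le> 2 * R * (6 * R) / (pi * (\<delta> ^ 3 * R / 24 / 2)\<^sup>2)"
  proof -
    have "diameter S * perimeter S \<le> 2 * R * (6 * R)"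
      using diam diam0 perim R
      by (meson mult_left_mono mult_right_mono order_trans less_imp_le mult_nonneg_nonneg zero_le_numeral)
    moreover have "pi * (\<delta> ^ 3 * R / 24 / 2)\<^sup>2 \<le> half_inball_volume S"
      unfolding vol using r R \<delta> by (intro mult_left_mono power_mono) (auto simp: mult.commute)
    ultimately show ?thesis
      using R \<delta> by (intro frac_le) auto
  qed
  also have "\<dots> = 27648 / (pi * \<delta> ^ 6)"
    using R \<delta> by (simp add: power_mult_distrib power_divide power2_eq_square field_simps flip: power_add)
  finally show ?A .
qed

section \<open>Regular subdivisions and Delaunay triangulations\<close>

definition minorant :: "'a::euclidean_space set \<Rightarrow> ('a \<Rightarrow> real) \<Rightarrow> 'a \<Rightarrow> real \<Rightarrow> bool" where
  "minorant X w p b \<longleftrightarrow> (\<forall>x\<in>X. p \<bullet> x + b \<le> w x)"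

definition contact :: "'a::euclidean_space set \<Rightarrow> ('a \<Rightarrow> real) \<Rightarrow> 'a \<Rightarrow> real \<Rightarrow> 'a set" where
  "contact X w p b = {x \<in> X. w x = p \<bullet> x + b}"

text \<open>The cells are the projections of the lower faces of the convex hull of the lifted points
  \<open>(x, w x)\<close>; a minorant is an affine function whose graph lies weakly below these
  points. A minorant without contact contributes the empty cell, in accordance with the convention
  on faces.\<close>

definition regular_subdivision :: "'a::euclidean_space set \<Rightarrow> ('a \<Rightarrow> real) \<Rightarrow> 'a set set" where
  "regular_subdivision X w = {convex hull (contact X w p b) | p b. minorant X w p b}"

lemma contact_subset: "contact X w p b \<subseteq> X"
  by (auto simp: contact_def)

lemma convex_hull_Int_supporting_hyperplane:
  fixes C :: "'a::euclidean_space set"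
  assumes "finite C" "\<And>x. x \<in> C \<Longrightarrow> a \<bullet> x \<le> c"
  shows "convex hull C \<inter> {x. a \<bullet> x = c} = convex hull {x \<in> C. a \<bullet> x = c}"
    and "convex hull C \<inter> {x. a \<bullet> x = c} face_of convex hull C"
proof -
  have "convex hull C \<subseteq> {x. a \<bullet> x \<le> c}"
    using assms by (intro hull_minimal convex_halfspace_le) auto
  then show face: "convex hull C \<inter> {x. a \<bullet> x = c} face_of convex hull C"
    by (intro face_of_Int_supporting_hyperplane_le) auto
  obtain S where "S \<subseteq> C" and S: "convex hull C \<inter> {x. a \<bullet> x = c} = convex hull S"
    using face_of_convex_hull_subset[OF finite_imp_compact[OF assms(1)] face] .
  have "S \<subseteq> {x \<in> C. a \<bullet> x = c}"
    using \<open>S \<subseteq> C\<close> S hull_subset[of S convex] by blast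
  then have "convex hull S \<subseteq> convex hull {x \<in> C. a \<bullet> x = c}"
    by (rule hull_mono)
  moreover have "convex hull {x \<in> C. a \<bullet> x = c} \<subseteq> convex hull C \<inter> {x. a \<bullet> x = c}"
    using hull_subset[of C convex] by (intro hull_minimal convex_Int convex_hyperplane) auto
  ultimately show "convex hull C \<inter> {x. a \<bullet> x = c} = convex hull {x \<in> C. a \<bullet> x = c}"
    using S by blast
qed

text \<open>The face is cut out of S by a hyperplane \<open>a \<bullet> x = c\<close>. Tilting the
  minorant slightly along \<open>a\<close> keeps the contact on the face and loses it on the rest of
  S; the finitely many points without contact have slack, so a small tilt does not reach
  them.\<close>

lemma regular_subdivision_face:
  fixes X :: "'a::euclidean_space set"
  assumes X: "finite X" and S: "S \<in> regular_subdivision X w" and F: "F face_of S"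
  shows "F \<in> regular_subdivision X w"
proof -
  obtain p b where min: "minorant X w p b" and S: "S = convex hull (contact X w p b)"
    using S by (auto simp: regular_subdivision_def)
  have fin: "finite (contact X w p b)"
    using X contact_subset finite_subset by metis
  have "F exposed_face_of S"
    using F fin S by (simp add: exposed_face_of_polyhedron polyhedron_convex_hull)
  then obtain a c where ac: "S \<subseteq> {x. a \<bullet> x \<le> c}" "F = S \<inter> {x. a \<bullet> x = c}"
    by (auto simp: exposed_face_of_def)
  have C: "a \<bullet> x \<le> c" if "x \<in> contact X w p b" for x
    using that ac(1) hull_inc[of x "contact X w p b" convex] by (auto simp: S)
  have "\<forall>x\<in>X - contact X w p b. \<forall>\<^sub>F d in at_right 0. d * (a \<bullet> x - c) < w x - (p \<bullet> x + b)"
  proof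
    fix x assume "x \<in> X - contact X w p b"
    then have "0 < w x - (p \<bullet> x + b)"
      using min by (fastforce simp: minorant_def contact_def)
    moreover have "((\<lambda>d. d * (a \<bullet> x - c)) \<longlongrightarrow> 0) (at_right 0)"
      by (intro tendsto_eq_intros) auto
    ultimately show "\<forall>\<^sub>F d in at_right 0. d * (a \<bullet> x - c) < w x - (p \<bullet> x + b)"
      by (intro order_tendstoD(2))
  qed
  then have "\<forall>\<^sub>F d in at_right 0. \<forall>x\<in>X - contact X w p b. d * (a \<bullet> x - c) < w x - (p \<bullet> x + b)"
    using X by (simp add: eventually_ball_finite)
  moreover have "\<forall>\<^sub>F d in at_right (0::real). 0 < d"
    by (rule eventually_at_right_less)
  ultimately have "\<forall>\<^sub>F d in at_right 0. 0 < d \<and>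
      (\<forall>x\<in>X - contact X w p b. d * (a \<bullet> x - c) < w x - (p \<bullet> x + b))"
    by eventually_elim auto
  from eventually_happens'[OF trivial_limit_at_right_real this] obtain d where d: "0 < d"
    "\<And>x. x \<in> X - contact X w p b \<Longrightarrow> d * (a \<bullet> x - c) < w x - (p \<bullet> x + b)"
    by blast
  define p' where "p' = p + d *\<^sub>R a"
  define b' where "b' = b - d * c"
  have eq: "p' \<bullet> x + b' = (p \<bullet> x + b) + d * (a \<bullet> x - c)" for x
    by (simp add: p'_def b'_def inner_add_left algebra_simps)
  have "minorant X w p' b'"
    unfolding minorant_def
  proof
    fix x assume "x \<in> X"
    show "p' \<bullet> x + b' \<le> w x"
    proof (cases "x \<in> contact X w p b")
      case True
      then have "d * (a \<bullet> x - c) \<le> 0"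
        using C[OF True] d(1) by (simp add: mult_nonneg_nonpos)
      then show ?thesis
        using True unfolding eq by (simp add: contact_def)
    next
      case False
      then show ?thesis
        using d(2)[of x] \<open>x \<in> X\<close> unfolding eq by auto
    qed
  qed
  moreover have "contact X w p' b' = {x \<in> contact X w p b. a \<bullet> x = c}"
  proof (intro equalityI subsetI)
    fix x assume x: "x \<in> contact X w p' b'"
    then have "x \<in> X" and w: "w x = (p \<bullet> x + b) + d * (a \<bullet> x - c)"
      by (auto simp: contact_def simp flip: eq)
    have "x \<in> contact X w p b"
      using d(2)[of x] \<open>x \<in> X\<close> w by force
    then show "x \<in> {x \<in> contact X w p b. a \<bullet> x = c}"
      using w d(1) by (auto simp: contact_def)
  qed (auto simp: contact_def eq)
  then have "F = convex hull (contact X w p' b')"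
    using convex_hull_Int_supporting_hyperplane(1)[OF fin C] ac S by simp
  ultimately show ?thesis
    by (auto simp: regular_subdivision_def)
qed

text \<open>The difference of two minorants separates their cells, and vanishes on both only where both
  are in contact.\<close>

lemma regular_subdivision_Int:
  fixes X :: "'a::euclidean_space set"
  assumes X: "finite X" and S: "S \<in> regular_subdivision X w" and T: "T \<in> regular_subdivision X w"
  shows "S \<inter> T face_of S"
proof -
  obtain p b where pb: "minorant X w p b" and S: "S = convex hull (contact X w p b)"
    using S by (auto simp: regular_subdivision_def)
  obtain p' b' where pb': "minorant X w p' b'" and T: "T = convex hull (contact X w p' b')"
    using T by (auto simp: regular_subdivision_def)
  have fin: "finite (contact X w p b)"
    using X contact_subset finite_subset by metis
  define a where "a = p' - p"
  define c where "c = b - b'"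
  have C: "a \<bullet> x \<le> c" if "x \<in> contact X w p b" for x
    using that pb' by (fastforce simp: a_def c_def inner_diff_left contact_def minorant_def)
  have "contact X w p' b' \<subseteq> {x. a \<bullet> x \<ge> c}"
    using pb by (fastforce simp: a_def c_def inner_diff_left contact_def minorant_def)
  then have T': "T \<subseteq> {x. a \<bullet> x \<ge> c}"
    unfolding T by (intro hull_minimal convex_halfspace_ge)
  have S': "S \<subseteq> {x. a \<bullet> x \<le> c}"
    unfolding S using C by (intro hull_minimal convex_halfspace_le) auto
  have "{x \<in> contact X w p b. a \<bullet> x = c} \<subseteq> contact X w p' b'"
    by (auto simp: a_def c_def inner_diff_left contact_def)
  moreover have "S \<inter> {x. a \<bullet> x = c} = convex hull {x \<in> contact X w p b. a \<bullet> x = c}"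
    using convex_hull_Int_supporting_hyperplane(1)[OF fin C] S by simp
  ultimately have "S \<inter> {x. a \<bullet> x = c} \<subseteq> T"
    using T hull_mono by metis
  then have "S \<inter> T = S \<inter> {x. a \<bullet> x = c}"
    using S' T' by force
  then show ?thesis
    using convex_hull_Int_supporting_hyperplane(2)[OF fin C] S by simp
qed

lemma simplicial_complex_regular_subdivision:
  fixes X :: "'a::euclidean_space set"
  assumes X: "finite X" and indep: "\<And>p b. minorant X w p b \<Longrightarrow> \<not> affine_dependent (contact X w p b)"
  shows "simplicial_complex (regular_subdivision X w)"
  unfolding simplicial_complex_def
proof (intro conjI ballI allI impI)
  have "regular_subdivision X w \<subseteq> (hull) convex ` Pow X"
    using contact_subset by (fastforce simp: regular_subdivision_def)
  then show "finite (regular_subdivision X w)"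
    using X by (meson finite_Pow_iff finite_imageI finite_subset)
  fix S assume S: "S \<in> regular_subdivision X w"
  then obtain p b where "minorant X w p b" "S = convex hull (contact X w p b)"
    by (auto simp: regular_subdivision_def)
  then have "(int (card (contact X w p b)) - 1) simplex S"
    using indep by (auto simp: simplex_def)
  then show "\<exists>n. n simplex S" ..
qed (use regular_subdivision_face[OF X] regular_subdivision_Int[OF X] in auto)

text \<open>The hypothesis says that \<open>y\<close> is interior to the convex hull of X. A
  hyperplane that supports the lifted hull from below at its lowest point over \<open>y\<close> is
  then not vertical, hence the graph of a minorant.\<close>

lemma regular_subdivision_covers:
  fixes X :: "'a::euclidean_space set"
  assumes X: "finite X" and y: "\<And>q. q \<noteq> 0 \<Longrightarrow> \<exists>x\<in>X. q \<bullet> x < q \<bullet> y"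
  shows "y \<in> \<Union>(regular_subdivision X w)"
proof -
  define g where "g x = (x, w x)" for x
  \<comment> \<open>separate the lifted hull from the open ray below its lowest point over \<open>y\<close>\<close>
  define P where "P = convex hull (g ` X)"
  have "\<exists>q::'a. q \<noteq> 0"
    using nonempty_Basis nonzero_Basis by blast
  then have "X \<noteq> {}"
    using y by blast
  have "y \<in> convex hull X"
  proof (rule ccontr)
    assume "y \<notin> convex hull X"
    then obtain a c where a: "a \<bullet> y < c" "\<And>x. x \<in> convex hull X \<Longrightarrow> c < a \<bullet> x"
      using separating_hyperplane_closed_point[of "convex hull X" y]
        compact_imp_closed[OF compact_convex_hull[OF finite_imp_compact[OF X]]] by auto
    then have "a \<noteq> 0"
      using \<open>X \<noteq> {}\<close> hull_inc[of _ X convex] by fastforce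
    then obtain x where "x \<in> X" "a \<bullet> x < a \<bullet> y"
      using y by blast
    then show False
      using a hull_inc[of x X convex] by fastforce
  qed
  moreover have "fst ` P = convex hull X"
    by (simp add: P_def g_def linear_fst image_image convex_hull_linear_image)
  ultimately have ne: "P \<inter> fst -` {y} \<noteq> {}"
    by (metis (no_types) IntI empty_iff image_iff vimage_singleton_eq)
  have "compact P"
    unfolding P_def using X by (intro compact_convex_hull finite_imp_compact) auto
  moreover have "closed (fst -` {y} :: ('a \<times> real) set)"
    by (intro closed_vimage continuous_intros)
  ultimately have "compact (P \<inter> fst -` {y})"
    by (rule compact_Int_closed)
  then obtain z where z: "z \<in> P \<inter> fst -` {y}" "\<And>z'. z' \<in> P \<inter> fst -` {y} \<Longrightarrow> snd z \<le> snd z'"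
    using continuous_attains_inf[OF _ ne, of snd] continuous_on_snd[OF continuous_on_id] by blast
  define m where "m = snd z"
  have m: "(y, m) \<in> P" "\<And>r. (y, r) \<in> P \<Longrightarrow> m \<le> r"
    using z by (auto simp: m_def)
  define T where "T = {y} \<times> {..<m}"
  have "convex T"
    unfolding T_def by (intro convex_Times) auto
  moreover have "T \<noteq> {}"
    by (auto simp: T_def)
  moreover have "P \<inter> T = {}"
    using m by (fastforce simp: T_def)
  moreover have "convex P" "P \<noteq> {}"
    using m by (auto simp: P_def)
  ultimately obtain v c where v: "v \<noteq> 0" "\<And>x. x \<in> T \<Longrightarrow> v \<bullet> x \<le> c" "\<And>x. x \<in> P \<Longrightarrow> c \<le> v \<bullet> x"
    using separating_hyperplane_sets[of T P] by blast
  obtain q s where qs: "v = (q, s)" by force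
  have T: "q \<bullet> y + s * r \<le> c" if "r < m" for r
    using v(2)[of "(y, r)"] that by (auto simp: T_def qs)
  have Xc: "c \<le> q \<bullet> x + s * w x" if "x \<in> X" for x
    using v(3)[of "(x, w x)"] hull_inc[of "(x, w x)" "g ` X" convex] that by (auto simp: qs P_def g_def)
  \<comment> \<open>Passing to the top of the open ray puts the lowest point \<open>(y, m)\<close>
    on the separating hyperplane.\<close>
  have lim: "q \<bullet> y + s * m \<le> c"
  proof (rule tendsto_upperbound)
    show "((\<lambda>r. q \<bullet> y + s * r) \<longlongrightarrow> q \<bullet> y + s * m) (at_left m)"
      by (intro tendsto_intros)
    show "\<forall>\<^sub>F r in at_left m. q \<bullet> y + s * r \<le> c"
      by (simp add: eventually_at_filter T)
  qed auto
  \<comment> \<open>The ray is unbounded below, so a negative \<open>s\<close> would push its points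
    to the wrong side.\<close>
  have "0 \<le> s"
  proof (rule ccontr)
    assume s: "\<not> 0 \<le> s"
    define r where "r = min (m - 1) ((c + 1 - q \<bullet> y) / s)"
    have "s * ((c + 1 - q \<bullet> y) / s) \<le> s * r"
      using s by (intro mult_left_mono_neg) (auto simp: r_def)
    moreover have "q \<bullet> y + s * r \<le> c"
      by (rule T) (simp add: r_def)
    ultimately show False
      using s by simp
  qed
  \<comment> \<open>A vertical hyperplane would have all of X on one side of \<open>y\<close>; this
    is where interiority is used.\<close>
  moreover have "s \<noteq> 0"
  proof
    assume "s = 0"
    then have "q \<noteq> 0" using v(1) qs by (auto simp: zero_prod_def)
    then obtain x where "x \<in> X" "q \<bullet> x < q \<bullet> y"
      using y by blast
    then show False
      using Xc[of x] lim \<open>s = 0\<close> by simp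
  qed
  ultimately have s: "0 < s" by simp
  \<comment> \<open>The equation of the hyperplane, solved for the last coordinate.\<close>
  define p where "p = (- 1 / s) *\<^sub>R q"
  define b where "b = c / s"
  have eq: "s * (p \<bullet> x + b) = c - q \<bullet> x" for x
    using s by (simp add: p_def b_def field_simps)
  have "minorant X w p b"
    unfolding minorant_def
  proof
    fix x assume "x \<in> X"
    have "s * (p \<bullet> x + b) \<le> s * w x"
      using Xc[OF \<open>x \<in> X\<close>] by (simp add: eq)
    then show "p \<bullet> x + b \<le> w x"
      using s by simp
  qed
  moreover have "y \<in> convex hull (contact X w p b)"
  proof -
    have neg: "- v \<bullet> x \<le> - c" if x: "x \<in> g ` X" for x
    proof -
      obtain x' where "x' \<in> X" "x = (x', w x')"
        using x by (auto simp: g_def)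
      then show ?thesis
        using Xc[of x'] by (simp add: qs)
    qed
    have "c \<le> q \<bullet> y + s * m"
      using v(3)[OF m(1)] by (simp add: qs)
    then have "(y, m) \<in> convex hull (g ` X) \<inter> {x. - v \<bullet> x = - c}"
      using lim m(1) by (simp add: qs P_def)
    then have "(y, m) \<in> convex hull {x \<in> g ` X. - v \<bullet> x = - c}"
      using convex_hull_Int_supporting_hyperplane(1)[of "g ` X" "- v" "- c"] neg X by auto
    then have "y \<in> fst ` (convex hull {x \<in> g ` X. - v \<bullet> x = - c})"
      by force
    also have "\<dots> = convex hull (fst ` {x \<in> g ` X. - v \<bullet> x = - c})"
      by (simp add: linear_fst convex_hull_linear_image)
    also have "\<dots> \<subseteq> convex hull (contact X w p b)"
    proof (intro hull_mono image_subsetI)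
      fix z assume "z \<in> {x \<in> g ` X. - v \<bullet> x = - c}"
      then obtain x where "x \<in> X" "z = (x, w x)" "s * w x = s * (p \<bullet> x + b)"
        by (auto simp: g_def qs eq)
      then show "fst z \<in> contact X w p b"
        using s by (simp add: contact_def)
    qed
    finally show ?thesis .
  qed
  ultimately show ?thesis
    by (auto simp: regular_subdivision_def)
qed

section \<open>Small generic perturbations of the heights\<close>

lemma eventually_notin_finite_at:
  fixes a :: "'a::t1_space"
  assumes "finite S"
  shows "\<forall>\<^sub>F t in at a. t \<notin> S"
  using islimpt_finite[OF assms] by (simp add: islimpt_iff_eventually)

text \<open>An affine dependence among contact points makes a polynomial in \<open>t\<close> vanish; distinct positive
  exponents keep that polynomial nonzero.\<close>

lemma eventually_contact_independent:
  fixes X :: "'a::euclidean_space set"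
  assumes X: "finite X" and k: "inj_on k X" "\<And>x. x \<in> X \<Longrightarrow> 0 < k x"
  shows "\<forall>\<^sub>F t::real in at_right 0. \<forall>p b. \<not> affine_dependent (contact X (\<lambda>x. w x + t ^ k x) p b)"
proof -
  have "\<forall>\<^sub>F t::real in at_right 0. \<forall>p b. contact X (\<lambda>x. w x + t ^ k x) p b \<noteq> Y"
    if Y: "Y \<subseteq> X" "affine_dependent Y" for Y
  proof -
    have fin: "finite Y"
      using X Y finite_subset by auto
    then obtain l v where l: "sum l Y = 0" "v \<in> Y" "l v \<noteq> 0" "(\<Sum>x\<in>Y. l x *\<^sub>R x) = 0"
      using affine_dependent_explicit_finite[of Y] Y by blast
    define P where "P = [:\<Sum>x\<in>Y. l x * w x:] + (\<Sum>x\<in>Y. monom (l x) (k x))"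
    have kv: "0 < k v"
      using k Y l(2) by auto
    \<comment> \<open>The exponents are distinct and positive, so only the term of \<open>v\<close>
      contributes in this degree.\<close>
    have "coeff P (k v) = (\<Sum>x\<in>Y. if x = v then l x else 0)"
      using k(1) kv Y l(2)
      by (auto simp: P_def coeff_sum coeff_pCons inj_on_def subset_iff intro!: sum.cong split: nat.split)
    also have "\<dots> \<noteq> 0"
      using l fin by (simp add: sum.delta)
    finally have "P \<noteq> 0" by auto
    then have "\<forall>\<^sub>F t in at_right 0. t \<notin> {t. poly P t = 0}"
      by (intro filter_leD[OF _ eventually_notin_finite_at[where a = 0, OF poly_roots_finite]] at_le) auto
    then show ?thesis
    proof eventually_elim
      case (elim t)
      have "poly P t = (\<Sum>x\<in>Y. l x * (w x + t ^ k x))"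
        by (simp add: P_def poly_sum poly_monom algebra_simps sum.distrib)
      \<comment> \<open>An affine dependence annihilates affine functions. If Y were a contact set,
        the heights on Y would be affine and \<open>t\<close> a root of P.\<close>
      moreover have "(\<Sum>x\<in>Y. l x * (p \<bullet> x + b)) = 0" for p b
      proof -
        have "(\<Sum>x\<in>Y. l x * (p \<bullet> x + b)) = p \<bullet> (\<Sum>x\<in>Y. l x *\<^sub>R x) + b * sum l Y"
          by (simp add: algebra_simps sum.distrib inner_sum_right sum_distrib_left)
        then show ?thesis using l by simp
      qed
      ultimately show ?case
        using elim by (auto simp: contact_def)
    qed
  qed
  then have "\<forall>\<^sub>F t::real in at_right 0. \<forall>Y\<in>{Y \<in> Pow X. affine_dependent Y}.
      \<forall>p b. contact X (\<lambda>x. w x + t ^ k x) p b \<noteq> Y"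
    using X by (intro eventually_ball_finite) auto
  then show ?thesis
  proof eventually_elim
    case (elim t)
    show ?case
      using elim contact_subset[of X "\<lambda>x. w x + t ^ k x"] by blast
  qed
qed

text \<open>This is the barycentric coordinate of \<open>y\<close>, extended to the whole space. It
  is read off from a hyperplane that exposes the face opposite to \<open>y\<close>.\<close>

lemma affine_dual_function:
  fixes Y :: "'a::euclidean_space set"
  assumes "\<not> affine_dependent Y" "y \<in> Y"
  obtains p b where "p \<bullet> y + b = 1" "\<And>x. x \<in> Y - {y} \<Longrightarrow> p \<bullet> x + b = 0"
proof -
  have fin: "finite Y"
    using assms aff_independent_finite by auto
  have "convex hull (Y - {y}) exposed_face_of convex hull Y"
    using assms fin
    by (auto simp: exposed_face_of_polyhedron polyhedron_convex_hull face_of_convex_hull_affine_independent)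
  then obtain a c where ac: "convex hull (Y - {y}) = convex hull Y \<inter> {x. a \<bullet> x = c}"
    by (auto simp: exposed_face_of_def)
  have "y \<notin> convex hull (Y - {y})"
    using assms convex_hull_subset_affine_hull by (fastforce simp: affine_dependent_def)
  then have "a \<bullet> y \<noteq> c"
    using assms(2) ac by (auto simp: hull_inc)
  moreover have "a \<bullet> x = c" if "x \<in> Y - {y}" for x
    using hull_inc[of x "Y - {y}" convex] that unfolding ac by auto
  ultimately show thesis
    by (intro that[of "(1 / (a \<bullet> y - c)) *\<^sub>R a" "- c / (a \<bullet> y - c)"])
       (auto simp flip: diff_divide_distrib)
qed

lemma affine_dual_basis:
  fixes Y :: "'a::euclidean_space set"
  assumes "\<not> affine_dependent Y"
  obtains P B where "\<And>x y. \<lbrakk>x \<in> Y; y \<in> Y\<rbrakk> \<Longrightarrow> P y \<bullet> x + B y = (if x = y then 1 else 0)"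
proof -
  have "\<forall>y\<in>Y. \<exists>pb. \<forall>x\<in>Y. fst pb \<bullet> x + snd pb = (if x = y then 1 else 0)"
  proof
    fix y assume "y \<in> Y"
    then obtain p b where "p \<bullet> y + b = 1" "\<And>x. x \<in> Y - {y} \<Longrightarrow> p \<bullet> x + b = 0"
      using affine_dual_function[OF assms] by blast
    then show "\<exists>pb. \<forall>x\<in>Y. fst pb \<bullet> x + snd pb = (if x = y then 1 else 0)"
      by (intro exI[of _ "(p, b)"]) auto
  qed
  then obtain f where "\<And>x y. \<lbrakk>x \<in> Y; y \<in> Y\<rbrakk> \<Longrightarrow> fst (f y) \<bullet> x + snd (f y) = (if x = y then 1 else 0)"
    by metis
  then show thesis
    by (intro that[of "\<lambda>y. fst (f y)" "\<lambda>y. snd (f y)"]) auto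
qed

lemma affine_functions_eq_on_hull:
  fixes p q :: "'a::euclidean_space"
  assumes "\<And>x. x \<in> Y \<Longrightarrow> p \<bullet> x + b = q \<bullet> x + c" "x \<in> affine hull Y"
  shows "p \<bullet> x + b = q \<bullet> x + c"
proof -
  have "affine hull Y \<subseteq> {x. (p - q) \<bullet> x = c - b}"
    using assms(1) by (intro hull_minimal affine_hyperplane) (auto simp: inner_diff_left algebra_simps)
  then show ?thesis
    using assms(2) by (auto simp: inner_diff_left algebra_simps)
qed

text \<open>With heights \<open>x \<bullet> x\<close> the slack of the affine function belonging to
  the sphere is \<open>(dist c x)\<^sup>2 - r\<^sup>2\<close>: zero on Y and positive on the rest of
  X. Adding the affine interpolation of the perturbation on Y keeps the contact on Y exact for every
  t, and for small t the positive slacks remain positive.\<close>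

lemma eventually_strict_sphere_mem:
  fixes X :: "'a::euclidean_space set"
  assumes X: "finite X" and k: "\<And>x. x \<in> X \<Longrightarrow> 0 < k x"
    and Y: "Y \<subseteq> X" "\<not> affine_dependent Y"
    and sphere: "0 \<le> r" "\<And>y. y \<in> Y \<Longrightarrow> dist c y = r" "\<And>x. x \<in> X - Y \<Longrightarrow> r < dist c x"
  shows "\<forall>\<^sub>F t::real in at_right 0. convex hull Y \<in> regular_subdivision X (\<lambda>x. x \<bullet> x + t ^ k x)"
proof -
  have fin: "finite Y"
    using X Y finite_subset by auto
  obtain P B where PB: "\<And>x y. \<lbrakk>x \<in> Y; y \<in> Y\<rbrakk> \<Longrightarrow> P y \<bullet> x + B y = (if x = y then 1 else 0)"
    using affine_dual_basis[OF Y(2)] by blast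
  define p where "p t = 2 *\<^sub>R c + (\<Sum>y\<in>Y. t ^ k y *\<^sub>R P y)" for t :: real
  define b where "b t = r\<^sup>2 - c \<bullet> c + (\<Sum>y\<in>Y. t ^ k y * B y)" for t :: real
  have eq: "x \<bullet> x + t ^ k x - (p t \<bullet> x + b t)
      = (dist c x)\<^sup>2 - r\<^sup>2 + t ^ k x - (\<Sum>y\<in>Y. t ^ k y * (P y \<bullet> x + B y))" for t x
    by (simp add: p_def b_def dist_norm power2_norm_eq_inner inner_diff_left inner_diff_right
        inner_add_left inner_sum_left inner_commute[of x c] algebra_simps sum.distrib)
  have on_Y: "x \<bullet> x + t ^ k x = p t \<bullet> x + b t" if "x \<in> Y" for x t
  proof -
    have "(\<Sum>y\<in>Y. t ^ k y * (P y \<bullet> x + B y)) = (\<Sum>y\<in>Y. if y = x then t ^ k y else 0)"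
      using PB that by (intro sum.cong) auto
    also have "\<dots> = t ^ k x"
      using fin that by (simp add: sum.delta)
    finally show ?thesis
      using eq[of x t] sphere(2)[OF that] by simp
  qed
  have "\<forall>x\<in>X - Y. \<forall>\<^sub>F t in at_right 0. p t \<bullet> x + b t < x \<bullet> x + t ^ k x"
  proof
    fix x assume x: "x \<in> X - Y"
    have "((\<lambda>t. (dist c x)\<^sup>2 - r\<^sup>2 + t ^ k x - (\<Sum>y\<in>Y. t ^ k y * (P y \<bullet> x + B y))) \<longlongrightarrow>
        (dist c x)\<^sup>2 - r\<^sup>2 + 0 ^ k x - (\<Sum>y\<in>Y. 0 ^ k y * (P y \<bullet> x + B y))) (at_right 0)"
      by (intro tendsto_intros)
    also have "(\<Sum>y\<in>Y. 0 ^ k y * (P y \<bullet> x + B y)) = 0"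
      using k Y by (intro sum.neutral) (auto simp: zero_power)
    finally have "((\<lambda>t. x \<bullet> x + t ^ k x - (p t \<bullet> x + b t)) \<longlongrightarrow> (dist c x)\<^sup>2 - r\<^sup>2) (at_right 0)"
      using k x by (simp add: eq zero_power)
    moreover have "0 < (dist c x)\<^sup>2 - r\<^sup>2"
      using sphere(1) sphere(3)[OF x] by (simp add: power_strict_mono)
    ultimately have "\<forall>\<^sub>F t in at_right 0. 0 < x \<bullet> x + t ^ k x - (p t \<bullet> x + b t)"
      by (rule order_tendstoD)
    then show "\<forall>\<^sub>F t in at_right 0. p t \<bullet> x + b t < x \<bullet> x + t ^ k x"
      by eventually_elim simp
  qed
  then have "\<forall>\<^sub>F t in at_right 0. \<forall>x\<in>X - Y. p t \<bullet> x + b t < x \<bullet> x + t ^ k x"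
    using X by (intro eventually_ball_finite) auto
  then show ?thesis
  proof eventually_elim
    case (elim t)
    have "minorant X (\<lambda>x. x \<bullet> x + t ^ k x) (p t) (b t)"
      using elim on_Y unfolding minorant_def by (metis DiffI less_le order_refl)
    moreover have "contact X (\<lambda>x. x \<bullet> x + t ^ k x) (p t) (b t) = Y"
      using elim on_Y Y(1) unfolding contact_def by force
    ultimately show ?case
      unfolding regular_subdivision_def by blast
  qed
qed

text \<open>Since Y affinely spans the space, a minorant with contact set Y is determined by the
  heights on Y. For the unperturbed heights the interpolating function exceeds
  \<open>x \<bullet> x\<close> at some point of X if no empty sphere passes through Y, and this
  strict inequality survives small perturbations.\<close>

lemma eventually_contact_empty_sphere:
  fixes X :: "'a::euclidean_space set"
  assumes X: "finite X" and k: "\<And>x. x \<in> X \<Longrightarrow> 0 < k x"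
    and Y: "Y \<subseteq> X" "\<not> affine_dependent Y" "card Y = DIM('a) + 1"
    and no_sphere: "\<nexists>c r. (\<forall>y\<in>Y. dist c y = r) \<and> (\<forall>x\<in>X. r \<le> dist c x)"
  shows "\<forall>\<^sub>F t::real in at_right 0. \<forall>p b. minorant X (\<lambda>x. x \<bullet> x + t ^ k x) p b \<longrightarrow>
           contact X (\<lambda>x. x \<bullet> x + t ^ k x) p b \<noteq> Y"
proof -
  have fin: "finite Y"
    using X Y finite_subset by auto
  have span: "affine hull Y = UNIV"
    using affine_independent_span_eq[OF Y(2)] Y(3) by simp
  obtain P B where PB: "\<And>x y. \<lbrakk>x \<in> Y; y \<in> Y\<rbrakk> \<Longrightarrow> P y \<bullet> x + B y = (if x = y then 1 else 0)"
    using affine_dual_basis[OF Y(2)] by blast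
  have interp: "p \<bullet> x + b = (\<Sum>y\<in>Y. f y * (P y \<bullet> x + B y))"
    if "\<And>y. y \<in> Y \<Longrightarrow> f y = p \<bullet> y + b" for p b x and f :: "'a \<Rightarrow> real"
  proof -
    have lin: "(\<Sum>y\<in>Y. f y * (P y \<bullet> x + B y)) = (\<Sum>y\<in>Y. f y *\<^sub>R P y) \<bullet> x + (\<Sum>y\<in>Y. f y * B y)" for x
      by (simp add: inner_sum_left algebra_simps sum.distrib)
    have "(\<Sum>y\<in>Y. f y * (P y \<bullet> x + B y)) = f x" if "x \<in> Y" for x
    proof -
      have "(\<Sum>y\<in>Y. f y * (P y \<bullet> x + B y)) = (\<Sum>y\<in>Y. if y = x then f y else 0)"
        using PB that by (intro sum.cong) auto
      then show ?thesis
        using fin that by (simp add: sum.delta)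
    qed
    then have "p \<bullet> y + b = (\<Sum>y\<in>Y. f y *\<^sub>R P y) \<bullet> y + (\<Sum>y\<in>Y. f y * B y)" if "y \<in> Y" for y
      using \<open>\<And>y. y \<in> Y \<Longrightarrow> f y = p \<bullet> y + b\<close> that by (metis lin)
    then show ?thesis
      unfolding lin using affine_functions_eq_on_hull[of Y p b _ _ x] by (simp only: span UNIV_I)
  qed
  define p where "p = (\<Sum>y\<in>Y. (y \<bullet> y) *\<^sub>R P y)"
  define b where "b = (\<Sum>y\<in>Y. (y \<bullet> y) * B y)"
  have pb: "p \<bullet> x + b = (\<Sum>y\<in>Y. (y \<bullet> y) * (P y \<bullet> x + B y))" for x
    by (simp add: p_def b_def inner_sum_left algebra_simps sum.distrib)
  have pbY: "p \<bullet> x + b = x \<bullet> x" if "x \<in> Y" for x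
  proof -
    have "(\<Sum>y\<in>Y. (y \<bullet> y) * (P y \<bullet> x + B y)) = (\<Sum>y\<in>Y. if y = x then y \<bullet> y else 0)"
      using PB that by (intro sum.cong) auto
    then show ?thesis
      using fin that by (simp add: pb sum.delta)
  qed
  have "\<exists>x\<in>X. x \<bullet> x < p \<bullet> x + b"
  proof (rule ccontr)
    assume "\<not> ?thesis"
    then have le: "p \<bullet> x + b \<le> x \<bullet> x" if "x \<in> X" for x
      using that by force
    \<comment> \<open>Completing the square: an affine function that agrees with
      \<open>x \<bullet> x\<close> on Y is that of the sphere with centre p/2, and lying below on X
      means that the sphere is empty.\<close>
    define c where "c = (1/2) *\<^sub>R p"
    have d: "(dist c x)\<^sup>2 = x \<bullet> x - (p \<bullet> x + b) + (c \<bullet> c + b)" for x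
      by (simp add: c_def dist_norm power2_norm_eq_inner inner_diff_left inner_diff_right
          inner_commute[of x p] field_simps)
    have "dist c y = sqrt (c \<bullet> c + b)" if "y \<in> Y" for y
      using d[of y] pbY[OF that] by (metis add_0 diff_self real_sqrt_abs abs_of_nonneg zero_le_dist)
    moreover have "sqrt (c \<bullet> c + b) \<le> dist c x" if "x \<in> X" for x
      using d[of x] le[OF that] by (intro real_le_lsqrt) auto
    ultimately show False
      using no_sphere by blast
  qed
  then obtain x where x: "x \<in> X" "x \<bullet> x < p \<bullet> x + b" ..
  have "((\<lambda>t. (\<Sum>y\<in>Y. (y \<bullet> y + t ^ k y) * (P y \<bullet> x + B y)) - (x \<bullet> x + t ^ k x)) \<longlongrightarrow>
       (\<Sum>y\<in>Y. (y \<bullet> y + 0 ^ k y) * (P y \<bullet> x + B y)) - (x \<bullet> x + 0 ^ k x)) (at_right 0)"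
    by (intro tendsto_intros)
  also have "(\<Sum>y\<in>Y. (y \<bullet> y + 0 ^ k y) * (P y \<bullet> x + B y)) = p \<bullet> x + b"
    unfolding pb
  proof (intro sum.cong refl)
    fix y assume "y \<in> Y"
    then have "0 < k y"
      using k Y(1) by blast
    then show "(y \<bullet> y + 0 ^ k y) * (P y \<bullet> x + B y) = (y \<bullet> y) * (P y \<bullet> x + B y)"
      by (simp add: zero_power)
  qed
  finally have "\<forall>\<^sub>F t in at_right 0. 0 < (\<Sum>y\<in>Y. (y \<bullet> y + t ^ k y) * (P y \<bullet> x + B y)) - (x \<bullet> x + t ^ k x)"
    by (rule order_tendstoD) (use x k in \<open>simp add: zero_power\<close>)
  then show ?thesis
  proof eventually_elim
    case (elim t)
    show ?case
    proof (intro allI impI notI)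
      fix p b assume min: "minorant X (\<lambda>x. x \<bullet> x + t ^ k x) p b"
        and cont: "contact X (\<lambda>x. x \<bullet> x + t ^ k x) p b = Y"
      have "p \<bullet> x + b = (\<Sum>y\<in>Y. (y \<bullet> y + t ^ k y) * (P y \<bullet> x + B y))"
        by (rule interp) (use cont in \<open>auto simp: contact_def\<close>)
      moreover have "p \<bullet> x + b \<le> x \<bullet> x + t ^ k x"
        using min x by (auto simp: minorant_def)
      ultimately show False
        using elim by linarith
    qed
  qed
qed

text \<open>Perturbing the heights \<open>x \<bullet> x\<close>, whose minorants in contact describe empty spheres, resolves
  cospherical point sets.\<close>

theorem delaunay_triangulation:
  fixes X :: "'a::euclidean_space set"
  assumes X: "finite X"
  obtains D where "simplicial_complex D"
    and "\<And>S. S \<in> D \<Longrightarrow> \<exists>Y\<subseteq>X. \<not> affine_dependent Y \<and> S = convex hull Y \<and>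
           (card Y = DIM('a) + 1 \<longrightarrow> (\<exists>c r. (\<forall>y\<in>Y. dist c y = r) \<and> (\<forall>x\<in>X. r \<le> dist c x)))"
    and "\<And>Y c r. \<lbrakk>Y \<subseteq> X; \<not> affine_dependent Y; 0 \<le> r; \<And>y. y \<in> Y \<Longrightarrow> dist c y = r;
           \<And>x. x \<in> X - Y \<Longrightarrow> r < dist c x\<rbrakk> \<Longrightarrow> convex hull Y \<in> D"
    and "\<And>y. (\<And>q. q \<noteq> 0 \<Longrightarrow> \<exists>x\<in>X. q \<bullet> x < q \<bullet> y) \<Longrightarrow> y \<in> \<Union>D"
proof -
  obtain k0 :: "'a \<Rightarrow> nat" where k0: "inj_on k0 X"
    using finite_imp_inj_to_nat_seg[OF X] by blast
  \<comment> \<open>\<open>Suc\<close> makes the exponents positive, so that the perturbation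
    vanishes at t = 0.\<close>
  define k where "k x = Suc (k0 x)" for x
  have k: "inj_on k X" "\<And>x. x \<in> X \<Longrightarrow> 0 < k x"
    using k0 by (auto simp: k_def inj_on_def)
  define w where "w t x = x \<bullet> x + t ^ k x" for t :: real and x :: 'a
  \<comment> \<open>\<open>sph\<close> allows further points of X on the sphere, \<open>str\<close>
    does not. Strict emptiness guarantees that a simplex occurs; a full-dimensional simplex that
    occurs is guaranteed only the weak form.\<close>
  define sph where "sph Y c r \<longleftrightarrow> (\<forall>y\<in>Y. dist c y = r) \<and> (\<forall>x\<in>X. r \<le> dist c x)" for Y c r
  define str where "str Y \<longleftrightarrow> (\<exists>c r. 0 \<le> r \<and> (\<forall>y\<in>Y. dist c y = r) \<and> (\<forall>x\<in>X - Y. r < dist c x))" for Y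
  have "\<forall>\<^sub>F t in at_right 0. \<forall>p b. \<not> affine_dependent (contact X (w t) p b)"
    unfolding w_def by (rule eventually_contact_independent[OF X k])
  moreover have "\<forall>\<^sub>F t in at_right 0. \<forall>Y\<in>{Y\<in>Pow X. \<not> affine_dependent Y \<and> str Y}.
      convex hull Y \<in> regular_subdivision X (w t)"
    unfolding w_def using X k(2)
    by (intro eventually_ball_finite) (auto simp: str_def intro: eventually_strict_sphere_mem)
  moreover have "\<forall>\<^sub>F t in at_right 0.
      \<forall>Y\<in>{Y\<in>Pow X. \<not> affine_dependent Y \<and> card Y = DIM('a) + 1 \<and> (\<nexists>c r. sph Y c r)}.
      \<forall>p b. minorant X (w t) p b \<longrightarrow> contact X (w t) p b \<noteq> Y"
    unfolding w_def sph_def using X k(2)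
    by (intro eventually_ball_finite ballI eventually_contact_empty_sphere) auto
  ultimately have "\<forall>\<^sub>F t in at_right 0.
      (\<forall>p b. \<not> affine_dependent (contact X (w t) p b)) \<and>
      (\<forall>Y\<in>{Y\<in>Pow X. \<not> affine_dependent Y \<and> str Y}. convex hull Y \<in> regular_subdivision X (w t)) \<and>
      (\<forall>Y\<in>{Y\<in>Pow X. \<not> affine_dependent Y \<and> card Y = DIM('a) + 1 \<and> (\<nexists>c r. sph Y c r)}.
      \<forall>p b. minorant X (w t) p b \<longrightarrow> contact X (w t) p b \<noteq> Y)"
    by eventually_elim blast
  from eventually_happens'[OF trivial_limit_at_right_real this] obtain t where t: "\<And>p b. \<not> affine_dependent (contact X (w t) p b)"
    "\<And>Y. \<lbrakk>Y \<subseteq> X; \<not> affine_dependent Y; str Y\<rbrakk> \<Longrightarrow> convex hull Y \<in> regular_subdivision X (w t)"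
    "\<And>Y p b. \<lbrakk>Y \<subseteq> X; \<not> affine_dependent Y; card Y = DIM('a) + 1; \<nexists>c r. sph Y c r;
       minorant X (w t) p b\<rbrakk> \<Longrightarrow> contact X (w t) p b \<noteq> Y"
    by force
  show thesis
  proof (rule that[of "regular_subdivision X (w t)"])
    show "simplicial_complex (regular_subdivision X (w t))"
      using t(1) by (intro simplicial_complex_regular_subdivision X)
    show "convex hull Y \<in> regular_subdivision X (w t)"
      if "Y \<subseteq> X" "\<not> affine_dependent Y" "0 \<le> r" "\<And>y. y \<in> Y \<Longrightarrow> dist c y = r"
        "\<And>x. x \<in> X - Y \<Longrightarrow> r < dist c x" for Y c r
      by (rule t(2)) (use that in \<open>auto simp: str_def intro!: exI[of _ c] exI[of _ r]\<close>)
    show "y \<in> \<Union> (regular_subdivision X (w t))" if "\<And>q. q \<noteq> 0 \<Longrightarrow> \<exists>x\<in>X. q \<bullet> x < q \<bullet> y" for y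
      by (rule regular_subdivision_covers[OF X that])
    fix S assume "S \<in> regular_subdivision X (w t)"
    then obtain p b where pb: "minorant X (w t) p b" "S = convex hull (contact X (w t) p b)"
      by (auto simp: regular_subdivision_def)
    then have "\<exists>c r. sph (contact X (w t) p b) c r" if "card (contact X (w t) p b) = DIM('a) + 1"
      using t(1) t(3)[of "contact X (w t) p b" p b] contact_subset that by metis
    then show "\<exists>Y\<subseteq>X. \<not> affine_dependent Y \<and> S = convex hull Y \<and>
         (card Y = DIM('a) + 1 \<longrightarrow> (\<exists>c r. (\<forall>y\<in>Y. dist c y = r) \<and> (\<forall>x\<in>X. r \<le> dist c x)))"
      using t(1) pb(2) unfolding sph_def
      by (intro exI[of _ "contact X (w t) p b"]) (auto simp: contact_def)
  qed
qed

section \<open>Separated nets\<close>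

lemma uniform_separation:
  fixes F :: "'a::heine_borel set set"
  assumes "finite F" "\<And>A. A \<in> F \<Longrightarrow> compact A"
  obtains c where "0 < c"
    "\<And>A B x y. \<lbrakk>A \<in> F; B \<in> F; A \<inter> B = {}; x \<in> A; y \<in> B\<rbrakk> \<Longrightarrow> c \<le> dist x y"
proof -
  have "\<forall>\<^sub>F c in at_right 0. \<forall>x\<in>fst P. \<forall>y\<in>snd P. c \<le> dist x y"
    if P: "P \<in> {P \<in> F \<times> F. fst P \<inter> snd P = {}}" for P
  proof -
    obtain d where "0 < d" "\<forall>x\<in>fst P. \<forall>y\<in>snd P. d \<le> dist x y"
      using separate_compact_closed[of "fst P" "snd P"] P assms(2) by (auto simp: compact_imp_closed mem_Times_iff)
    then show ?thesis
      by (intro eventually_at_rightI[of 0 d]) (auto intro: order_trans less_imp_le)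
  qed
  then have "\<forall>\<^sub>F c in at_right 0. \<forall>P\<in>{P \<in> F \<times> F. fst P \<inter> snd P = {}}. \<forall>x\<in>fst P. \<forall>y\<in>snd P. c \<le> dist x y"
    using assms(1) by (intro eventually_ball_finite) auto
  moreover have "\<forall>\<^sub>F c in at_right (0::real). 0 < c"
    by (rule eventually_at_right_less)
  ultimately have "\<forall>\<^sub>F c in at_right 0. 0 < c \<and>
      (\<forall>P\<in>{P \<in> F \<times> F. fst P \<inter> snd P = {}}. \<forall>x\<in>fst P. \<forall>y\<in>snd P. c \<le> dist x y)"
    by eventually_elim blast
  from eventually_happens'[OF trivial_limit_at_right_real this] that show thesis
    by force
qed

lemma finite_pos_lower_bound:
  fixes f :: "'b \<Rightarrow> real"
  assumes "finite A" "\<And>a. a \<in> A \<Longrightarrow> 0 < f a"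
  obtains c where "0 < c" "c \<le> 1" "\<And>a. a \<in> A \<Longrightarrow> c \<le> f a"
proof
  show "0 < Min (insert 1 (f ` A))" "Min (insert 1 (f ` A)) \<le> 1"
    using assms by (auto simp: Min_gr_iff)
  show "Min (insert 1 (f ` A)) \<le> f a" if "a \<in> A" for a
    using assms that by (intro Min_le) auto
qed

text \<open>A separated set of largest size cannot be extended, so every point of B is near it or
  near A. No separation is asked within A itself, since cut points may be closer together than
  H.\<close>

lemma maximal_separated_net:
  fixes B A :: "'a::metric_space set"
  assumes "compact B" "0 < H"
  obtains S where "finite S" "S \<subseteq> B" "\<And>x y. \<lbrakk>x \<in> S; y \<in> S \<union> A; x \<noteq> y\<rbrakk> \<Longrightarrow> H \<le> dist x y"
    "\<And>z. z \<in> B \<Longrightarrow> \<exists>x\<in>A \<union> S. dist x z < H"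
proof -
  define Q where "Q S \<longleftrightarrow> finite S \<and> S \<subseteq> B \<and> (\<forall>x\<in>S. \<forall>y\<in>S \<union> A. x \<noteq> y \<longrightarrow> H \<le> dist x y)" for S
  obtain C where C: "finite C" "B \<subseteq> (\<Union>c\<in>C. ball c (H / 2))"
    using assms by (metis compact_eq_totally_bounded half_gt_zero)
  \<comment> \<open>A ball of radius H/2 contains at most one point of S, so a finite cover of B
    bounds the size.\<close>
  have bound: "card S < Suc (card C)" if "Q S" for S
  proof -
    have "\<forall>x\<in>S. \<exists>c\<in>C. dist c x < H / 2"
      using that C(2) by (fastforce simp: Q_def)
    then obtain f where f: "\<And>x. x \<in> S \<Longrightarrow> f x \<in> C" "\<And>x. x \<in> S \<Longrightarrow> dist (f x) x < H / 2"
      by metis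
    have "inj_on f S"
    proof (rule inj_onI, rule ccontr)
      fix x y assume xy: "x \<in> S" "y \<in> S" "f x = f y" "x \<noteq> y"
      then have "H \<le> dist x y"
        using that by (auto simp: Q_def)
      moreover have "dist x y \<le> dist (f x) x + dist (f x) y"
        by (metis dist_commute dist_triangle)
      ultimately show False
        using f(2)[OF xy(1)] f(2)[OF xy(2)] xy(3) by simp
    qed
    then have "card S \<le> card C"
      using f(1) C(1) by (intro card_inj_on_le[of f]) auto
    then show ?thesis by simp
  qed
  have "Q {}" by (simp add: Q_def)
  then obtain S where S: "Q S" "\<And>T. Q T \<Longrightarrow> card T \<le> card S"
    using ex_has_greatest_nat[of Q "{}" card "Suc (card C)"] bound by (meson less_imp_le)
  show thesis
  proof (rule that[of S])
    show "finite S" "S \<subseteq> B" "\<And>x y. \<lbrakk>x \<in> S; y \<in> S \<union> A; x \<noteq> y\<rbrakk> \<Longrightarrow> H \<le> dist x y"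
      using S(1) by (auto simp: Q_def)
    fix z assume z: "z \<in> B"
    show "\<exists>x\<in>A \<union> S. dist x z < H"
    proof (rule ccontr)
      assume "\<not> ?thesis"
      then have far: "\<And>x. x \<in> A \<union> S \<Longrightarrow> H \<le> dist x z" by force
      then have "z \<notin> S"
        using assms(2) by fastforce
      moreover have "Q (insert z S)"
        using S(1) z far unfolding Q_def by (auto simp: dist_commute)
      ultimately show False
        using S(2)[of "insert z S"] S(1) by (simp add: Q_def)
    qed
  qed
qed

section \<open>Cutting the edges\<close>

text \<open>With \<open>2 * h \<le> r\<close>, the term 1/2 stops the multiples of h so that the
  last gap before \<open>r\<close> is between h/2 and 3h/2: neither too short for the separation of
  cut points nor too long for the discs. The radius 0 is the vertex itself.\<close>

definition shell_radii :: "real \<Rightarrow> real \<Rightarrow> real set" where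
  "shell_radii h r = insert r ((\<lambda>k. real k * h) ` {..nat \<lfloor>r / h - 1 / 2\<rfloor>})"

context
  fixes h r :: real
  assumes h: "0 < h" and r: "2 * h \<le> r"
begin

private definition N where "N = nat \<lfloor>r / h - 1 / 2\<rfloor>"

private lemma N: "real N * h + h / 2 \<le> r" "r < real N * h + 3 * h / 2"
proof -
  have "2 \<le> r / h"
    using h r by (simp add: field_simps)
  then have "real N \<le> r / h - 1 / 2" "r / h - 1 / 2 < real N + 1"
    unfolding N_def by linarith+
  then have "real N * h \<le> (r / h - 1 / 2) * h" "(r / h - 1 / 2) * h < (real N + 1) * h"
    using h by (auto intro!: mult_right_mono mult_strict_right_mono)
  then show "real N * h + h / 2 \<le> r" "r < real N * h + 3 * h / 2"
    using h by (auto simp: algebra_simps)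
qed

private lemma multiple_less: "real k * h + h \<le> real l * h" if "k < l"
proof -
  have "(real k + 1) * h \<le> real l * h"
    using that h by (intro mult_right_mono) auto
  then show ?thesis
    by (simp add: algebra_simps)
qed

private lemma multiple_bound: "real k * h + h / 2 \<le> r" if "k \<le> N"
  using that N(1) multiple_less[of k N] h by (cases "k = N") auto

private lemma radii: "t \<in> shell_radii h r \<longleftrightarrow> t = r \<or> (\<exists>k\<le>N. t = real k * h)"
  by (auto simp: shell_radii_def N_def)

lemma shell_radii_range: "t \<in> shell_radii h r \<Longrightarrow> 0 \<le> t \<and> t \<le> r"
  using h r multiple_bound by (fastforce simp: radii)

lemma shell_radii_ge: "\<lbrakk>t \<in> shell_radii h r; t \<noteq> 0\<rbrakk> \<Longrightarrow> h \<le> t"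
  using h r multiple_less[of 0] by (fastforce simp: radii)

lemma shell_radii_cases: "t \<in> shell_radii h r \<Longrightarrow> t = r \<or> (\<exists>k::nat. t = real k * h)"
  by (auto simp: radii)

lemma shell_radii_gap: "\<lbrakk>s \<in> shell_radii h r; t \<in> shell_radii h r; s < t\<rbrakk> \<Longrightarrow> h / 2 \<le> t - s"
proof -
  assume s: "s \<in> shell_radii h r" and t: "t \<in> shell_radii h r" and "s < t"
  then have "s \<noteq> r"
    using shell_radii_range[OF t] by auto
  then obtain k where k: "k \<le> N" "s = real k * h"
    using s by (auto simp: radii)
  consider "t = r" | l where "l \<le> N" "t = real l * h"
    using t by (auto simp: radii)
  then show "h / 2 \<le> t - s"
  proof cases
    case 1
    then show ?thesis using multiple_bound[OF k(1)] k by simp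
  next
    case 2
    then have "k < l"
      using \<open>s < t\<close> k h by simp
    then show ?thesis using multiple_less[of k l] 2 k h by simp
  qed
qed

text \<open>The conclusions on \<open>k\<close> serve to compare radii of different spokes at one
  vertex: a multiple of h from another spoke can lie strictly between \<open>s\<close> and
  \<open>t\<close> only if \<open>t\<close> is the end \<open>r\<close>.\<close>

lemma shell_radii_bracket:
  assumes "0 \<le> z" "z \<le> r"
  obtains s t k where "s \<in> shell_radii h r" "t \<in> shell_radii h r" "s \<le> z" "z \<le> t" "s < t"
    "t - s \<le> 3 * h / 2" "\<And>u. u \<in> shell_radii h r \<Longrightarrow> u \<le> s \<or> t \<le> u"
    "s = real k * h" "t = r \<or> t = real (Suc k) * h"
proof (cases "real N * h \<le> z")
  case True
  show thesis
  proof (rule that[of "real N * h" r N])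
    show "u \<le> real N * h \<or> r \<le> u" if "u \<in> shell_radii h r" for u
      using that h by (auto simp: radii)
  qed (use True assms N h in \<open>auto simp: radii\<close>)
next
  case False
  define k where "k = nat \<lfloor>z / h\<rfloor>"
  have "0 \<le> z / h"
    using assms h by simp
  then have "real k \<le> z / h" "z / h < real k + 1"
    unfolding k_def by linarith+
  then have k: "real k * h \<le> z" "z < real (Suc k) * h"
    using h by (auto simp: field_simps)
  then have "real k * h < real N * h"
    using False by simp
  then have "k < N"
    using h by simp
  show thesis
  proof (rule that[of "real k * h" "real (Suc k) * h" k])
    show "u \<le> real k * h \<or> real (Suc k) * h \<le> u" if u: "u \<in> shell_radii h r" for u
    proof -
      consider "u = r" | l where "l \<le> N" "u = real l * h"
        using u by (auto simp: radii)
      then show ?thesis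
      proof cases
        case 1
        then show ?thesis
          using multiple_bound[of "Suc k"] \<open>k < N\<close> h by simp
      next
        case 2
        then show ?thesis
          using h by (cases "l \<le> k") auto
      qed
    qed
    show "real (Suc k) * h \<in> shell_radii h r"
    proof -
      have "Suc k \<le> N"
        using \<open>k < N\<close> by simp
      then show ?thesis
        unfolding radii by blast
    qed
  qed (use k h \<open>k < N\<close> in \<open>auto simp: radii algebra_simps\<close>)
qed

end

lemma finite_shell_radii: "finite (shell_radii h r)"
  by (simp add: shell_radii_def)

lemma end_in_shell_radii: "r \<in> shell_radii h r"
  by (simp add: shell_radii_def)

section \<open>Arc length on segments, and facts on spheres and unit vectors\<close>

lemma dist_scaleR_sgn:
  fixes v m :: "'a::real_normed_vector"
  shows "dist v m *\<^sub>R sgn (m - v) = m - v"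
  by (cases "v = m") (auto simp: sgn_div_norm dist_norm norm_minus_commute)

lemma closed_segment_sgn:
  fixes v m :: "'a::euclidean_space"
  shows "z \<in> closed_segment v m \<longleftrightarrow> (\<exists>t. 0 \<le> t \<and> t \<le> dist v m \<and> z = v + t *\<^sub>R sgn (m - v))"
proof (cases "v = m")
  case False
  then have L: "0 < norm (m - v)" by simp
  have "z \<in> closed_segment v m \<longleftrightarrow> (\<exists>u. 0 \<le> u \<and> u \<le> 1 \<and> z = v + u *\<^sub>R (m - v))"
    by (auto simp: closed_segment_def algebra_simps)
  also have "\<dots> \<longleftrightarrow> (\<exists>t. 0 \<le> t \<and> t \<le> dist v m \<and> z = v + t *\<^sub>R sgn (m - v))"
  proof (intro iffI; elim exE conjE)
    fix u assume "0 \<le> u" "u \<le> 1" "z = v + u *\<^sub>R (m - v)"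
    then show "\<exists>t. 0 \<le> t \<and> t \<le> dist v m \<and> z = v + t *\<^sub>R sgn (m - v)"
      using L by (intro exI[of _ "u * norm (m - v)"]) (auto simp: sgn_div_norm dist_norm norm_minus_commute mult_left_le_one_le)
  next
    fix t assume "0 \<le> t" "t \<le> dist v m" "z = v + t *\<^sub>R sgn (m - v)"
    moreover have "t *\<^sub>R sgn (m - v) = (t / norm (m - v)) *\<^sub>R (m - v)"
      by (simp add: sgn_div_norm divide_inverse)
    ultimately show "\<exists>u. 0 \<le> u \<and> u \<le> 1 \<and> z = v + u *\<^sub>R (m - v)"
      using L by (intro exI[of _ "t / norm (m - v)"]) (auto simp: dist_norm norm_minus_commute)
  qed
  finally show ?thesis .
qed auto

text \<open>The ball and the sphere of radius \<open>s\<close> about the origin are tangent at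
  \<open>s u\<close>. Both ends of a piece are such points for the disc over it:
  \<open>s < \<mu>\<close> at one end and \<open>s > \<mu>\<close> at the other.\<close>

lemma ball_shell_touch:
  fixes y u :: "'a::real_inner"
  assumes "norm u = 1" "0 < \<mu>" "0 \<le> s" "norm y = s" "norm (y - \<mu> *\<^sub>R u) \<le> \<bar>\<mu> - s\<bar>"
  shows "y = s *\<^sub>R u"
proof -
  have uu: "u \<bullet> u = 1" and yy: "y \<bullet> y = s\<^sup>2"
    using assms by (auto simp flip: power2_norm_eq_inner)
  have "(norm (y - \<mu> *\<^sub>R u))\<^sup>2 \<le> \<bar>\<mu> - s\<bar>\<^sup>2"
    using assms(5) by (intro power_mono) auto
  moreover have "(norm (y - \<mu> *\<^sub>R u))\<^sup>2 = s\<^sup>2 - 2 * \<mu> * (y \<bullet> u) + \<mu>\<^sup>2"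
    unfolding power2_norm_eq_inner
    by (simp add: inner_diff_left inner_diff_right uu yy inner_commute[of u y] power2_eq_square algebra_simps)
  ultimately have "s\<^sup>2 - 2 * \<mu> * (y \<bullet> u) + \<mu>\<^sup>2 \<le> (\<mu> - s)\<^sup>2"
    by simp
  then have "\<mu> * s \<le> \<mu> * (y \<bullet> u)"
    by (simp add: power2_eq_square algebra_simps)
  then have "s \<le> y \<bullet> u"
    using assms(2) by simp
  then have "s * s \<le> s * (y \<bullet> u)"
    using assms(3) by (rule mult_left_mono)
  moreover have "(norm (y - s *\<^sub>R u))\<^sup>2 = s\<^sup>2 - 2 * s * (y \<bullet> u) + s\<^sup>2"
    unfolding power2_norm_eq_inner
    by (simp add: inner_diff_left inner_diff_right uu yy inner_commute[of u y] power2_eq_square algebra_simps)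
  ultimately have "(norm (y - s *\<^sub>R u))\<^sup>2 \<le> 0"
    by (simp add: power2_eq_square)
  then show ?thesis by simp
qed

text \<open>The law of cosines, with the angle expressed by the chord between \<open>u\<close> and
  \<open>w\<close>. For s and t at least h it bounds the distance below by h times the
  chord.\<close>

lemma norm_scaled_unit_diff:
  fixes u w :: "'a::real_inner"
  assumes "norm u = 1" "norm w = 1"
  shows "(norm (s *\<^sub>R u - t *\<^sub>R w))\<^sup>2 = (s - t)\<^sup>2 + s * t * (norm (u - w))\<^sup>2"
proof -
  have "u \<bullet> u = 1" "w \<bullet> w = 1"
    using assms by (auto simp flip: power2_norm_eq_inner)
  then show ?thesis
    unfolding power2_norm_eq_inner
    by (simp add: inner_diff_left inner_diff_right inner_commute[of w u] power2_eq_square algebra_simps)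
qed

text \<open>A spoke \<open>(v, m)\<close> is the half of an edge from its vertex \<open>v\<close> to its midpoint \<open>m\<close>.\<close>

locale spokes =
  fixes V :: "'a::euclidean_space set" and E :: "('a \<times> 'a) set"
  assumes finite_V: "finite V" and finite_E: "finite E"
    and spoke: "(v, m) \<in> E \<Longrightarrow> v \<in> V \<and> v \<noteq> m"
    and same_center: "\<lbrakk>(v, m) \<in> E; (v, m') \<in> E; m \<noteq> m'\<rbrakk> \<Longrightarrow>
      closed_segment v m \<inter> closed_segment v m' = {v}"
    and different_center: "\<lbrakk>(v, m) \<in> E; (v', m') \<in> E; v \<noteq> v'\<rbrakk> \<Longrightarrow>
      closed_segment v m \<inter> closed_segment v' m' = {} \<or> m = m' \<and> m = midpoint v v'"
    and center_in_spoke: "\<lbrakk>u \<in> V; (v, m) \<in> E; u \<in> closed_segment v m\<rbrakk> \<Longrightarrow> u = v"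
begin

definition features :: "'a set set" where
  "features = (\<lambda>v. {v}) ` V \<union> (\<lambda>(v, m). {m}) ` E \<union> (\<lambda>(v, m). closed_segment v m) ` E"

text \<open>The angle between spokes at a vertex enters as the chord of unit directions, which makes
  \<open>\<kappa>\<close> independent of scale. The cap \<open>\<kappa> \<le> 1\<close> lets
  \<open>\<kappa> * h / 2\<close> also serve as a bound for gaps of h/2 along one spoke.\<close>

definition separated_by :: "real \<Rightarrow> real \<Rightarrow> bool" where
  "separated_by c \<kappa> \<longleftrightarrow> 0 < c \<and> 0 < \<kappa> \<and> \<kappa> \<le> 1 \<and>
     (\<forall>A\<in>features. \<forall>B\<in>features. A \<inter> B = {} \<longrightarrow> (\<forall>x\<in>A. \<forall>y\<in>B. c \<le> dist x y)) \<and>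
     (\<forall>v m m'. (v, m) \<in> E \<longrightarrow> (v, m') \<in> E \<longrightarrow> m \<noteq> m' \<longrightarrow> \<kappa> \<le> norm (sgn (m - v) - sgn (m' - v)))"

text \<open>V is added because an isolated vertex has no spoke.\<close>

definition shell_points :: "real \<Rightarrow> 'a set" where
  "shell_points h = V \<union> (\<Union>(v, m)\<in>E. (\<lambda>s. v + s *\<^sub>R sgn (m - v)) ` shell_radii h (dist v m))"

lemma norm_sgn_spoke: "(v, m) \<in> E \<Longrightarrow> norm (sgn (m - v)) = 1"
  using spoke[of v m] by (auto simp: norm_sgn)

lemma separated_by_exists: obtains c \<kappa> where "separated_by c \<kappa>"
proof -
  have "finite features"
    using finite_V finite_E by (simp add: features_def)
  moreover have "compact A" if "A \<in> features" for A
    using that by (auto simp: features_def)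
  ultimately obtain c where c: "0 < c"
    "\<And>A B x y. \<lbrakk>A \<in> features; B \<in> features; A \<inter> B = {}; x \<in> A; y \<in> B\<rbrakk> \<Longrightarrow> c \<le> dist x y"
    using uniform_separation by metis
  define P where "P = {((v, m), (v', m')) | v m v' m'. (v, m) \<in> E \<and> (v', m') \<in> E \<and> v = v' \<and> m \<noteq> m'}"
  have "finite P"
    by (rule finite_subset[of _ "E \<times> E"]) (use finite_E in \<open>auto simp: P_def\<close>)
  moreover define f where "f = (\<lambda>((v::'a, m::'a), (v'::'a, m'::'a)). norm (sgn (m - v) - sgn (m' - v)))"
  have "0 < f e" if e: "e \<in> P" for e
  proof -
    obtain v m m' where vm: "e = ((v, m), (v, m'))" "(v, m) \<in> E" "(v, m') \<in> E" "m \<noteq> m'"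
      using e by (auto simp: P_def)
    \<comment> \<open>Spokes with the same direction would share an initial piece and not just their
      centre.\<close>
    have "sgn (m - v) \<noteq> sgn (m' - v)"
    proof
      assume eq: "sgn (m - v) = sgn (m' - v)"
      define t where "t = min (dist v m) (dist v m')"
      have t: "0 < t" "t \<le> dist v m" "t \<le> dist v m'"
        using spoke vm by (auto simp: t_def)
      define x where "x = v + t *\<^sub>R sgn (m - v)"
      have "x \<in> closed_segment v m" "x \<in> closed_segment v m'"
        using t eq unfolding x_def closed_segment_sgn by (auto intro!: exI[of _ t])
      then have "x = v"
        using same_center[OF vm(2-4)] by blast
      then show False
        using t norm_sgn_spoke[OF vm(2)] by (auto simp: x_def)
    qed
    then show ?thesis
      by (simp add: vm f_def)
  qed
  ultimately obtain \<kappa> where \<kappa>: "0 < \<kappa>" "\<kappa> \<le> 1" "\<And>e. e \<in> P \<Longrightarrow> \<kappa> \<le> f e"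
    using finite_pos_lower_bound[of P f] by blast
  have "separated_by c \<kappa>"
    unfolding separated_by_def
  proof (intro conjI allI impI ballI)
    fix v m m' assume "(v, m) \<in> E" "(v, m') \<in> E" "m \<noteq> m'"
    then have "((v, m), (v, m')) \<in> P" by (auto simp: P_def)
    from \<kappa>(3)[OF this] show "\<kappa> \<le> norm (sgn (m - v) - sgn (m' - v))" by (simp add: f_def)
  qed (use c \<kappa> in auto)
  then show thesis ..
qed

context
  fixes c \<kappa> h :: real
  assumes sep: "separated_by c \<kappa>" and h: "0 < h" "4 * h \<le> c"
begin

private lemma kappa: "0 < \<kappa>" "\<kappa> \<le> 1"
  using sep by (auto simp: separated_by_def)

private lemma far: "\<lbrakk>A \<in> features; B \<in> features; A \<inter> B = {}; x \<in> A; y \<in> B\<rbrakk> \<Longrightarrow> 4 * h \<le> dist x y"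
  using sep h(2) unfolding separated_by_def by (meson order_trans)

private lemma features_I:
  "v \<in> V \<Longrightarrow> {v} \<in> features"
  "(v, m) \<in> E \<Longrightarrow> {m} \<in> features"
  "(v, m) \<in> E \<Longrightarrow> closed_segment v m \<in> features"
  by (force simp: features_def)+

private lemma far_centers: "\<lbrakk>v \<in> V; v' \<in> V; v \<noteq> v'\<rbrakk> \<Longrightarrow> 4 * h \<le> dist v v'"
  using far[of "{v}" "{v'}" v v'] features_I by auto

private lemma spoke_length: "(v, m) \<in> E \<Longrightarrow> 4 * h \<le> dist v m"
  using far[of "{v}" "{m}" v m] features_I spoke by auto

private lemma far_center_spoke:
  "\<lbrakk>u \<in> V; (v, m) \<in> E; u \<noteq> v; y \<in> closed_segment v m\<rbrakk> \<Longrightarrow> 4 * h \<le> dist u y"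
  using far[of "{u}" "closed_segment v m" u y] features_I(1)[of u] features_I(3)[of v m]
    center_in_spoke[of u v m] by blast

private lemma far_end_spoke:
  "\<lbrakk>(v, m) \<in> E; (v, m') \<in> E; m \<noteq> m'; y \<in> closed_segment v m'\<rbrakk> \<Longrightarrow> 4 * h \<le> dist m y"
proof -
  assume E: "(v, m) \<in> E" "(v, m') \<in> E" "m \<noteq> m'" "y \<in> closed_segment v m'"
  have "m \<notin> closed_segment v m'"
    using same_center[OF E(1-3)] spoke[OF E(1)] by auto
  then show ?thesis
    using far[of "{m}" "closed_segment v m'" m y] features_I E by auto
qed

private lemma far_spokes:
  "\<lbrakk>(v, m) \<in> E; (v', m') \<in> E; closed_segment v m \<inter> closed_segment v' m' = {};
    x \<in> closed_segment v m; y \<in> closed_segment v' m'\<rbrakk> \<Longrightarrow> 4 * h \<le> dist x y"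
  using far[of "closed_segment v m" "closed_segment v' m'" x y] features_I by auto

private lemma radii_spoke: "(v, m) \<in> E \<Longrightarrow> 2 * h \<le> dist v m"
  using spoke_length[of v m] h by simp

private lemma shell_point_in_segment:
  "\<lbrakk>(v, m) \<in> E; s \<in> shell_radii h (dist v m)\<rbrakk> \<Longrightarrow> v + s *\<^sub>R sgn (m - v) \<in> closed_segment v m"
  using shell_radii_range[OF h(1) radii_spoke] unfolding closed_segment_sgn by blast

text \<open>The two halves of an edge meet at its midpoint; coordinates on the far half are
  rewritten as coordinates along the near one, where they exceed \<open>dist v m\<close> or equal
  it.\<close>

private lemma opposite:
  assumes "(v, m) \<in> E" "m = midpoint v v'"
  shows "v' + t *\<^sub>R sgn (m - v') = v + (2 * dist v m - t) *\<^sub>R sgn (m - v)" "dist v' m = dist v m"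
proof -
  have "2 *\<^sub>R m = v + v'"
    by (simp add: assms(2) midpoint_def)
  then have v'2: "v' = 2 *\<^sub>R m - v"
    by (simp add: algebra_simps)
  then have m: "m - v' = - (m - v)" "v' = v + 2 *\<^sub>R (m - v)"
    by (simp_all add: algebra_simps scaleR_2)
  have "m - v = dist v m *\<^sub>R sgn (m - v)"
    by (simp add: dist_scaleR_sgn)
  then have v': "v' = v + (2 * dist v m) *\<^sub>R sgn (m - v)"
    using m(2) by (metis scaleR_scaleR)
  have "sgn (m - v') = - sgn (m - v)"
    unfolding m(1) by (rule sgn_minus)
  then show "v' + t *\<^sub>R sgn (m - v') = v + (2 * dist v m - t) *\<^sub>R sgn (m - v)"
    by (subst v') (simp add: algebra_simps)
  show "dist v' m = dist v m"
    using m(1) by (metis dist_norm norm_minus_cancel norm_minus_commute)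
qed

lemma shell_points_finite: "finite (shell_points h)"
  using finite_V finite_E by (auto simp: shell_points_def finite_shell_radii)

lemma shell_points_subset: "shell_points h \<subseteq> V \<union> (\<Union>(v, m)\<in>E. closed_segment v m)"
  using shell_point_in_segment by (auto simp: shell_points_def)

text \<open>Points of one spoke, or of the two halves of an edge, are at least h/2 apart; points
  other than the centre on two spokes at a vertex at least \<open>\<kappa> * h\<close>; points on
  disjoint features at least 4h.\<close>

lemma shell_points_separated:
  assumes x: "x \<in> shell_points h" and y: "y \<in> shell_points h" and "x \<noteq> y"
  shows "\<kappa> * h / 2 \<le> dist x y"
proof -
  have small: "\<kappa> * h \<le> h"
    using kappa h by simp
  have center: "\<kappa> * h / 2 \<le> dist v y" if "v \<in> V" "y \<in> shell_points h" "v \<noteq> y" for v y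
    using that(2) unfolding shell_points_def
  proof (elim UnE UN_E, goal_cases)
    case 1
    then show ?thesis
      using far_centers[OF that(1) 1 that(3)] small h by linarith
  next
    case (2 e)
    then obtain v' m s where e: "(v', m) \<in> E" "s \<in> shell_radii h (dist v' m)" "y = v' + s *\<^sub>R sgn (m - v')"
      by (auto split: prod.splits)
    show ?thesis
    proof (cases "v = v'")
      case True
      then have "s \<noteq> 0" using e that by auto
      then have "h \<le> s"
        using shell_radii_ge[OF h(1) radii_spoke] e by blast
      moreover have "dist v y = s"
        using True e norm_sgn_spoke[OF e(1)] \<open>h \<le> s\<close> h by (simp add: dist_norm)
      ultimately show ?thesis
        using small h by linarith
    next
      case False
      then have "4 * h \<le> dist v y"
        using far_center_spoke[OF that(1) e(1) False] shell_point_in_segment e by blast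
      then show ?thesis
        using small h by linarith
    qed
  qed
  show ?thesis
  proof (cases "x \<in> V \<or> y \<in> V")
    case True
    then show ?thesis
      using center[of x y] center[of y x] x y \<open>x \<noteq> y\<close> by (auto simp: dist_commute)
  next
    case False
    then obtain v m s where e: "(v, m) \<in> E" "s \<in> shell_radii h (dist v m)" "x = v + s *\<^sub>R sgn (m - v)"
      using x by (auto simp: shell_points_def)
    obtain v' m' s' where e': "(v', m') \<in> E" "s' \<in> shell_radii h (dist v' m')" "y = v' + s' *\<^sub>R sgn (m' - v')"
      using y False by (auto simp: shell_points_def)
    have "s \<noteq> 0" "s' \<noteq> 0"
      using False e e' spoke by auto
    then have s: "h \<le> s" "h \<le> s'"
      using shell_radii_ge[OF h(1) radii_spoke] e e' by blast+
    consider "v = v'" "m = m'" | "v = v'" "m \<noteq> m'" | "v \<noteq> v'" by blast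
    then show ?thesis
    proof cases
      case 1
      then have "s \<noteq> s'" using e e' \<open>x \<noteq> y\<close> by auto
      then have "h / 2 \<le> \<bar>s - s'\<bar>"
        using shell_radii_gap[OF h(1) radii_spoke[OF e(1)], of s s']
          shell_radii_gap[OF h(1) radii_spoke[OF e(1)], of s' s] e(2) e'(2) 1
        by (cases s s' rule: linorder_cases) auto
      moreover have "x - y = (s - s') *\<^sub>R sgn (m - v)"
        using e e' 1 by (simp add: algebra_simps)
      then have "dist x y = \<bar>s - s'\<bar>"
        using norm_sgn_spoke[OF e(1)] by (simp add: dist_norm)
      ultimately show ?thesis
        using small by linarith
    next
      case 2
      have \<kappa>: "\<kappa> \<le> norm (sgn (m - v) - sgn (m' - v))"
        using sep e e' 2 by (auto simp: separated_by_def)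
      \<comment> \<open>Law of cosines: both radii are at least h, and the difference of the radii
        is discarded.\<close>
      have "(\<kappa> * h)\<^sup>2 = h * h * \<kappa>\<^sup>2"
        by (simp add: power2_eq_square)
      also have "\<dots> \<le> s * s' * (norm (sgn (m - v) - sgn (m' - v)))\<^sup>2"
        using s h kappa \<kappa> by (intro mult_mono power_mono) auto
      also have "\<dots> \<le> (norm (s *\<^sub>R sgn (m - v) - s' *\<^sub>R sgn (m' - v)))\<^sup>2"
        using norm_scaled_unit_diff[OF norm_sgn_spoke[OF e(1)], of "sgn (m' - v)" s s']
          norm_sgn_spoke[OF e'(1)] 2 by simp
      also have "\<dots> = (dist x y)\<^sup>2"
        using e e' 2 by (simp add: dist_norm)
      finally have "\<kappa> * h \<le> dist x y"
        by (rule power2_le_imp_le) simp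
      moreover have "0 \<le> \<kappa> * h"
        using kappa h by simp
      ultimately show ?thesis by linarith
    next
      case 3
      from different_center[OF e(1) e'(1) 3] show ?thesis
      proof
        assume "closed_segment v m \<inter> closed_segment v' m' = {}"
        then have "4 * h \<le> dist x y"
          using far_spokes[OF e(1) e'(1)] shell_point_in_segment e e' by blast
        then show ?thesis
          using small h by linarith
      next
        assume m: "m = m' \<and> m = midpoint v v'"
        then have y: "y = v + (2 * dist v m - s') *\<^sub>R sgn (m - v)" and r: "dist v' m' = dist v m"
          using opposite[OF e(1)] e' by auto
        have "x - y = (s + s' - 2 * dist v m) *\<^sub>R sgn (m - v)"
          unfolding e(3) y by (simp add: algebra_simps)
        then have d: "dist x y = \<bar>s + s' - 2 * dist v m\<bar>"
          using norm_sgn_spoke[OF e(1)] by (simp add: dist_norm)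
        note gap = shell_radii_gap[OF h(1) radii_spoke[OF e(1)] _ end_in_shell_radii]
          and range = shell_radii_range[OF h(1) radii_spoke[OF e(1)]]
        \<comment> \<open>The points differ, so at least one is not the midpoint and stays h/2 short
          of it; the two deficits add up.\<close>
        have "s \<noteq> dist v m \<or> s' \<noteq> dist v m"
          using d \<open>x \<noteq> y\<close> by auto
        then have "h / 2 \<le> (dist v m - s) + (dist v m - s')"
          using gap[of s] gap[of s'] range[of s] range[of s'] e(2) e'(2) unfolding r by force
        then show ?thesis
          using d small by linarith
      qed
    qed
  qed
qed

text \<open>The piece is an edge of the Gabriel graph of the cut points. Its disc lies in the
  annulus of radii \<open>s\<close> and \<open>t\<close> about \<open>v\<close> and touches the two
  circles only at \<open>a\<close> and \<open>b\<close>. A further cut point in the disc would need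
  a distance from \<open>v\<close> strictly between two consecutive radii.\<close>

lemma shell_points_gabriel:
  assumes vm: "(v, m) \<in> E" and z: "z \<in> closed_segment v m"
  obtains a b where "a \<in> shell_points h" "b \<in> shell_points h" "a \<noteq> b" "dist a b < 2 * h"
    "z \<in> closed_segment a b" "closed_segment a b \<subseteq> closed_segment v m"
    "\<And>x. x \<in> shell_points h - {a, b} \<Longrightarrow> dist a b / 2 < dist (midpoint a b) x"
proof -
  define r where "r = dist v m"
  define u where "u = sgn (m - v)"
  have u: "norm u = 1"
    using norm_sgn_spoke[OF vm] by (simp add: u_def)
  have r: "2 * h \<le> r"
    using radii_spoke[OF vm] by (simp add: r_def)
  have mr: "m = v + r *\<^sub>R u"
    by (simp add: r_def u_def dist_scaleR_sgn)
  obtain z0 where z0: "0 \<le> z0" "z0 \<le> r" "z = v + z0 *\<^sub>R u"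
    using z unfolding closed_segment_sgn r_def u_def by blast
  obtain s t k where st: "s \<in> shell_radii h r" "t \<in> shell_radii h r" "s \<le> z0" "z0 \<le> t" "s < t"
    "t - s \<le> 3 * h / 2" "\<And>u. u \<in> shell_radii h r \<Longrightarrow> u \<le> s \<or> t \<le> u"
    "s = real k * h" "t = r \<or> t = real (Suc k) * h"
    using shell_radii_bracket[OF h(1) r z0(1,2)] by metis
  have s0: "0 \<le> s" and tr: "t \<le> r"
    using shell_radii_range[OF h(1) r] st by auto
  define a where "a = v + s *\<^sub>R u"
  define b where "b = v + t *\<^sub>R u"
  define \<mu> where "\<mu> = (s + t) / 2"
  have pt: "v + q *\<^sub>R u \<in> shell_points h" if "q \<in> shell_radii h r" for q
    using that vm by (auto simp: shell_points_def u_def r_def)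
  have "b - a = (t - s) *\<^sub>R u"
    by (simp add: a_def b_def algebra_simps)
  then have "norm (b - a) = t - s"
    using u st(5) by simp
  then have dab: "dist a b = t - s"
    by (simp add: dist_norm norm_minus_commute)
  have mid: "midpoint a b = v + \<mu> *\<^sub>R u"
    by (simp add: midpoint_def a_def b_def \<mu>_def algebra_simps)
       (simp add: scaleR_add_left[symmetric] add_divide_distrib flip: scaleR_2)
  have on_line: "v + q *\<^sub>R u \<in> closed_segment a b \<longleftrightarrow> s \<le> q \<and> q \<le> t" for q
  proof -
    have "u \<noteq> 0" using u by auto
    then show ?thesis
      using mem_closed_segment_line[of u v q s t] st(5)
      by (simp add: a_def b_def closed_segment_eq_real_ivl)
  qed
  have seg_line: "\<exists>q. s \<le> q \<and> q \<le> t \<and> y = v + q *\<^sub>R u" if "y \<in> closed_segment a b" for y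
  proof -
    have "closed_segment a b = (+) v ` (\<lambda>q. q *\<^sub>R u) ` closed_segment s t"
      unfolding a_def b_def using closed_segment_linear_image[of "\<lambda>q. q *\<^sub>R u" s t]
      by (simp add: closed_segment_translation linear_scaleR_left)
    then show ?thesis
      using that st(5) by (auto simp: closed_segment_eq_real_ivl)
  qed
  have sub: "closed_segment a b \<subseteq> closed_segment v m"
  proof
    fix y assume "y \<in> closed_segment a b"
    then obtain q where "s \<le> q" "q \<le> t" "y = v + q *\<^sub>R u"
      using seg_line by blast
    then show "y \<in> closed_segment v m"
      unfolding closed_segment_sgn using s0 tr by (auto simp: r_def u_def intro!: exI[of _ q])
  qed
  have c: "midpoint a b \<in> closed_segment v m"
    using sub by auto
  have "x = a \<or> x = b" if x: "x \<in> shell_points h" "dist (midpoint a b) x \<le> dist a b / 2" for x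
  proof -
    have rad: "dist (midpoint a b) x \<le> (t - s) / 2"
      using x dab by simp
    have near: "dist (midpoint a b) x < 4 * h"
    proof -
      have "(t - s) / 2 \<le> 3 * h / 4"
        using st(6) by simp
      moreover have "3 * h / 4 < 4 * h"
        using h(1) by simp
      ultimately show ?thesis
        using rad by linarith
    qed
    have nx: "norm (x - v - \<mu> *\<^sub>R u) \<le> (t - s) / 2"
      using rad unfolding mid dist_norm by (simp add: norm_minus_commute algebra_simps)
    have \<mu>: "0 < \<mu>" "norm (\<mu> *\<^sub>R u) = \<mu>"
      using s0 st(5) u by (auto simp: \<mu>_def)
    have dvx: "s \<le> norm (x - v)" "norm (x - v) \<le> t"
    proof -
      have "\<bar>norm (x - v) - \<mu>\<bar> \<le> (t - s) / 2"
        using norm_triangle_ineq3[of "x - v" "\<mu> *\<^sub>R u"] nx \<mu>(2) by simp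
      moreover have "s = \<mu> - (t - s) / 2" "t = \<mu> + (t - s) / 2"
        by (simp_all add: \<mu>_def field_simps)
      ultimately show "s \<le> norm (x - v)" "norm (x - v) \<le> t"
        by (simp_all only: abs_le_iff) linarith+
    qed
    have xa: "x = a" if "norm (x - v) = s"
    proof -
      have "x - v = s *\<^sub>R u"
        by (rule ball_shell_touch[OF u \<mu>(1) s0 that]) (use nx st(5) in \<open>simp add: \<mu>_def\<close>)
      then show ?thesis by (simp add: a_def algebra_simps)
    qed
    have xb: "x = b" if "norm (x - v) = t"
    proof -
      have "x - v = t *\<^sub>R u"
        by (rule ball_shell_touch[OF u \<mu>(1) _ that]) (use nx st(5) s0 in \<open>auto simp: \<mu>_def\<close>)
      then show ?thesis by (simp add: b_def algebra_simps)
    qed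
    consider "x \<in> V" | v' m' t' where "(v', m') \<in> E" "t' \<in> shell_radii h (dist v' m')"
        "x = v' + t' *\<^sub>R sgn (m' - v')"
      using x(1) by (auto simp: shell_points_def)
    then show ?thesis
    proof cases
      case 1
      have "x = v"
      proof (rule ccontr)
        assume "x \<noteq> v"
        then show False
          using far_center_spoke[OF 1 vm _ c] near by (simp add: dist_commute)
      qed
      then show ?thesis
        using dvx s0 xa by simp
    next
      case 2
      have xseg: "x \<in> closed_segment v' m'"
        using shell_point_in_segment 2 by blast
      have t'0: "0 \<le> t'"
        using shell_radii_range[OF h(1) radii_spoke[OF 2(1)] 2(2)] by simp
      consider "v' = v" "m' = m" | "v' = v" "m' \<noteq> m" | "v' \<noteq> v" by blast
      then show ?thesis
      proof cases
        case A: 1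
        then have "norm (x - v) = t'"
          using 2 t'0 u by (simp add: u_def)
        then have "t' = s \<or> t' = t"
          using st(7)[of t'] 2(2) A dvx by (auto simp: r_def)
        then show ?thesis
          using xa xb \<open>norm (x - v) = t'\<close> by auto
      next
        case B: 2
        have nt: "norm (x - v) = t'"
          using 2 B t'0 norm_sgn_spoke[OF 2(1)] by simp
        show ?thesis
        proof (rule ccontr)
          assume ne: "\<not> ?thesis"
          then have lt: "s < t'" "t' < t"
            using dvx nt xa xb by force+
          \<comment> \<open>Otherwise the point is the end of another spoke at \<open>v\<close>,
            hence 4h away from the spoke of the piece.\<close>
          have "t' \<noteq> dist v' m'"
          proof
            assume "t' = dist v' m'"
            then have "x = m'"
              using 2(3) by (simp add: dist_scaleR_sgn)
            then show False
              using far_end_spoke[of v m' m "midpoint a b"] 2(1) vm B c near by (simp add: dist_commute)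
          qed
          then obtain l where l: "t' = real l * h"
            using shell_radii_cases[OF h(1) radii_spoke[OF 2(1)] 2(2)] by blast
          \<comment> \<open>No multiple of h lies strictly between consecutive multiples, so the
            piece is the last one. Its end is the midpoint \<open>m\<close>, which is 4h away from
            the other spoke.\<close>
          have "t = r"
          proof (rule ccontr)
            assume "t \<noteq> r"
            then have "real k * h < real l * h" "real l * h < real (Suc k) * h"
              using st lt l by auto
            then have "k < l" "l < Suc k"
              using h by (auto simp only: mult_less_cancel_right_pos of_nat_less_iff)
            then show False by simp
          qed
          then have "b = m"
            by (simp add: b_def mr)
          have "dist b x \<le> dist (midpoint a b) b + dist (midpoint a b) x"
            by (metis dist_commute dist_triangle)
          also have "\<dots> \<le> t - s"
            using rad dab by (simp add: dist_midpoint field_simps)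
          finally have "dist m x < 4 * h"
            using st(6) h(1) \<open>b = m\<close> by simp
          then show False
            using far_end_spoke[of v m m' x] vm 2(1) B xseg by simp
        qed
      next
        case C: 3
        \<comment> \<open>Only the other half of the same edge is near. Its points are at distance
          at least \<open>r\<close> from \<open>v\<close>, so the annulus leaves only distance
          \<open>t\<close>.\<close>
        have "closed_segment v m \<inter> closed_segment v' m' \<noteq> {}"
          using far_spokes[OF vm 2(1) _ c xseg] near by force
        then have m: "m = m'" "m = midpoint v v'"
          using different_center[OF vm 2(1)] C by auto
        have "x = v + (2 * r - t') *\<^sub>R u" and r': "dist v' m' = r"
          using opposite[OF vm m(2)] 2(3) m(1) by (auto simp: r_def u_def)
        moreover have "t' \<le> r"
          using shell_radii_range[OF h(1) radii_spoke[OF 2(1)] 2(2)] r' by simp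
        ultimately have "norm (x - v) = 2 * r - t'"
          using u r h by simp
        then have "norm (x - v) = t"
          using dvx tr \<open>t' \<le> r\<close> by simp
        then show ?thesis
          using xb by simp
      qed
    qed
  qed
  then have gab: "dist a b / 2 < dist (midpoint a b) x" if "x \<in> shell_points h - {a, b}" for x
    using that by force
  show thesis
  proof (rule that[of a b])
    show "a \<in> shell_points h" "b \<in> shell_points h"
      using pt st(1,2) by (auto simp: a_def b_def)
    show "a \<noteq> b"
      using dab st(5) by auto
    show "dist a b < 2 * h"
      using dab st(6) h(1) by simp
    show "z \<in> closed_segment a b"
      using on_line[of z0] z0(3) st(3,4) by simp
  qed (use sub gab in auto)
qed

end

end

section \<open>The subdivision in the plane\<close>

lemma simplicial_complex_Int_face:
  "\<lbrakk>simplicial_complex K; S \<in> K; T \<in> K\<rbrakk> \<Longrightarrow> S \<inter> T face_of S"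
  unfolding simplicial_complex_def by blast

lemma simplicial_complex_face:
  "\<lbrakk>simplicial_complex K; S \<in> K; F face_of S\<rbrakk> \<Longrightarrow> F \<in> K"
  unfolding simplicial_complex_def by blast

lemma simplicial_complex_simplex:
  assumes "simplicial_complex K" "S \<in> K"
  obtains n where "n simplex S"
  using assms unfolding simplicial_complex_def by blast

lemma vertex_in_edge:
  fixes K :: "'a::euclidean_space set set"
  assumes "simplicial_complex K" "closed_segment v w \<in> K" "{u} \<in> K" "u \<in> closed_segment v w"
  shows "u = v \<or> u = w"
proof -
  have "closed_segment v w \<inter> {u} face_of closed_segment v w"
    using assms by (intro simplicial_complex_Int_face)
  moreover have "closed_segment v w \<inter> {u} = {u}"
    using assms(4) by blast
  ultimately show ?thesis
    by (simp add: face_of_singleton extreme_point_of_segment)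
qed

lemma edge_ends:
  fixes K :: "'a::euclidean_space set set"
  assumes "simplicial_complex K" "closed_segment v w \<in> K"
  shows "{v} \<in> K" "{w} \<in> K"
proof -
  have "{v} face_of closed_segment v w" "{w} face_of closed_segment v w"
    by (auto simp: face_of_singleton extreme_point_of_segment)
  then show "{v} \<in> K" "{w} \<in> K"
    using assms by (blast intro: simplicial_complex_face)+
qed

lemma half_segment:
  fixes v w :: "'a::euclidean_space"
  assumes "v \<noteq> w"
  shows "closed_segment v (midpoint v w) \<subseteq> closed_segment v w" "w \<notin> closed_segment v (midpoint v w)"
proof -
  show "closed_segment v (midpoint v w) \<subseteq> closed_segment v w"
    by (simp add: subset_closed_segment)
  have "dist v w / 2 < dist v w"
    using assms by simp
  then show "w \<notin> closed_segment v (midpoint v w)"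
    using dist_in_closed_segment[of w v "midpoint v w"] by (auto simp: dist_midpoint dist_commute)
qed

definition half_edges :: "'a::euclidean_space set set \<Rightarrow> ('a \<times> 'a) set" where
  "half_edges K = {(v, midpoint v w) | v w. v \<noteq> w \<and> closed_segment v w \<in> K}"

text \<open>The intersection of two edges is a face of each. If it contains a point in the open part
  of an edge it contains both ends of that edge, and these, being vertices, are ends of the other
  edge as well.\<close>

lemma spokes_half_edges:
  fixes K :: "'a::euclidean_space set set"
  assumes K: "simplicial_complex K"
  shows "spokes {v. {v} \<in> K} (half_edges K)"
proof
  have "finite K"
    using K by (simp add: simplicial_complex_def)
  then have "finite ((\<lambda>v. {v}) -` K)"
    by (intro finite_vimageI) auto
  then show V: "finite {v. {v} \<in> K}"
    by (simp add: vimage_def)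
  have "half_edges K \<subseteq> (\<lambda>(v, w). (v, midpoint v w)) ` ({v. {v} \<in> K} \<times> {v. {v} \<in> K})"
    using edge_ends[OF K] by (force simp: half_edges_def)
  then show "finite (half_edges K)"
    using V by (meson finite_SigmaI finite_imageI finite_subset)
next
  fix v m assume "(v, m) \<in> half_edges K"
  then obtain w where w: "v \<noteq> w" "closed_segment v w \<in> K" "m = midpoint v w"
    by (auto simp: half_edges_def)
  then show "v \<in> {v. {v} \<in> K} \<and> v \<noteq> m"
    using edge_ends[OF K w(2)] by (metis mem_Collect_eq midpoint_eq_endpoint(1))
next
  fix v m m' assume "(v, m) \<in> half_edges K" "(v, m') \<in> half_edges K" "m \<noteq> m'"
  then obtain w w' where w: "v \<noteq> w" "closed_segment v w \<in> K" "m = midpoint v w"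
    and w': "v \<noteq> w'" "closed_segment v w' \<in> K" "m' = midpoint v w'" and "w \<noteq> w'"
    by (auto simp: half_edges_def)
  have face: "closed_segment v w \<inter> closed_segment v w' face_of closed_segment v w"
    using K w w' by (intro simplicial_complex_Int_face)
  have "w \<notin> closed_segment v w'"
    using vertex_in_edge[OF K w'(2) edge_ends(2)[OF K w(2)]] \<open>w \<noteq> w'\<close> w by auto
  have "x = v" if x: "x \<in> closed_segment v m" "x \<in> closed_segment v m'" for x
  proof (rule ccontr)
    assume "x \<noteq> v"
    have xs: "x \<in> closed_segment v w" "x \<in> closed_segment v w'" "x \<noteq> w"
      using x half_segment[OF w(1)] half_segment[OF w'(1)] w w' by auto
    then have "x \<in> open_segment v w"
      using \<open>x \<noteq> v\<close> by (simp add: open_segment_def)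
    then have "w \<in> closed_segment v w \<inter> closed_segment v w'"
      using face_ofD[OF face] xs by simp
    then show False
      using \<open>w \<notin> closed_segment v w'\<close> by blast
  qed
  then show "closed_segment v m \<inter> closed_segment v m' = {v}"
    by auto
next
  fix v m v' m' assume "(v, m) \<in> half_edges K" "(v', m') \<in> half_edges K" "v \<noteq> v'"
  then obtain w w' where w: "v \<noteq> w" "closed_segment v w \<in> K" "m = midpoint v w"
    and w': "v' \<noteq> w'" "closed_segment v' w' \<in> K" "m' = midpoint v' w'"
    by (auto simp: half_edges_def)
  have face: "closed_segment v w \<inter> closed_segment v' w' face_of closed_segment v w"
    using K w w' by (intro simplicial_complex_Int_face)
  note sub = half_segment[OF w(1), folded w(3)] half_segment[OF w'(1), folded w'(3)]
  show "closed_segment v m \<inter> closed_segment v' m' = {} \<or> m = m' \<and> m = midpoint v v'"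
  proof (rule ccontr)
    assume neg: "\<not> ?thesis"
    then obtain x where x: "x \<in> closed_segment v m" "x \<in> closed_segment v' m'"
      by blast
    have "x \<noteq> v"
      using vertex_in_edge[OF K w'(2) edge_ends(1)[OF K w(2)]] x sub \<open>v \<noteq> v'\<close> by blast
    have xs: "x \<in> closed_segment v w" "x \<in> closed_segment v' w'" "x \<noteq> w"
      using x sub by auto
    then have "x \<in> open_segment v w"
      using \<open>x \<noteq> v\<close> by (simp add: open_segment_def)
    then have "v \<in> closed_segment v' w'" "w \<in> closed_segment v' w'"
      using face_ofD[OF face] xs by auto
    then have "v = w'" "w = v'"
      using vertex_in_edge[OF K w'(2)] edge_ends[OF K w(2)] \<open>v \<noteq> v'\<close> \<open>v \<noteq> w\<close> by blast+
    then show False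
      using neg w w' by (simp add: midpoint_sym)
  qed
next
  fix u v m assume u: "u \<in> {v. {v} \<in> K}" and "(v, m) \<in> half_edges K" "u \<in> closed_segment v m"
  then obtain w where w: "v \<noteq> w" "closed_segment v w \<in> K" "m = midpoint v w"
    by (auto simp: half_edges_def)
  then show "u = v"
    using vertex_in_edge[OF K w(2), of u] half_segment[OF w(1)] u \<open>u \<in> closed_segment v m\<close> by blast
qed

section \<open>Delaunay cells inside a plane complex\<close>

lemma simplicial_complex_subset:
  assumes "simplicial_complex D" "M \<subseteq> D" "\<And>S F. \<lbrakk>S \<in> M; F face_of S\<rbrakk> \<Longrightarrow> F \<in> M"
  shows "simplicial_complex M"
  using assms unfolding simplicial_complex_def by (meson finite_subset subsetD)

lemma two_simplex_frontier:
  fixes T :: "'a::euclidean_space set"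
  assumes dim: "DIM('a) = 2" and K: "simplicial_complex K" and T: "T \<in> K" "aff_dim T = 2"
  shows "T - interior T = \<Union>{F. F facet_of T}" "frontier T = T - interior T"
    and "F facet_of T \<Longrightarrow> F \<in> K \<and> aff_dim F = 1"
proof -
  obtain n where n: "n simplex T"
    using simplicial_complex_simplex[OF K T(1)] .
  have "affine hull T = UNIV"
    using T(2) dim by (simp flip: aff_dim_eq_full)
  then show "T - interior T = \<Union>{F. F facet_of T}"
    using rel_boundary_of_polyhedron[OF simplex_imp_polyhedron[OF n]] by (simp add: rel_interior_interior)
  show "frontier T = T - interior T"
    using closed_simplex[OF n] by (simp add: frontier_def)
  show "F \<in> K \<and> aff_dim F = 1" if "F facet_of T"
    using that K T by (auto simp: facet_of_def intro: simplicial_complex_face)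
qed

text \<open>The larger of the bound for edges and the bound for triangles; the same holds for
  \<open>inradius_ratio_bound\<close>.\<close>

definition disc_ratio_bound :: "real \<Rightarrow> real" where
  "disc_ratio_bound \<delta> = max 4 (27648 / (pi * \<delta> ^ 6))"

definition inradius_ratio_bound :: "real \<Rightarrow> real" where
  "inradius_ratio_bound \<delta> = max 2 (48 / \<delta> ^ 3)"

lemma subdivision_at_scale:
  fixes K :: "'a::euclidean_space set set"
  assumes dim: "DIM('a) = 2" and K: "simplicial_complex K"
    and sep: "spokes.separated_by {v. {v} \<in> K} (half_edges K) c \<kappa>" and h: "0 < h" "4 * h \<le> c"
  obtains M M' where "subdivision_of M K" "subcomplex_of M' M"
    "\<Union>M - \<Union>M' \<subseteq> {x. \<exists>y\<in>\<Union>(skeleton 1 K). norm (x - y) \<le> 4 * h}"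
    "regularity_constant M \<le> disc_ratio_bound (\<kappa> / 4) + 2 * inradius_ratio_bound (\<kappa> / 4)"
    "regularity_constant M' \<le> disc_ratio_bound 1 + 2 * inradius_ratio_bound 1"
proof -
  interpret spokes "{v. {v} \<in> K}" "half_edges K"
    by (rule spokes_half_edges[OF K])
  have \<kappa>: "0 < \<kappa>" "\<kappa> \<le> 1"
    using sep by (auto simp: separated_by_def)
  define Z where "Z = shell_points h"
  have "finite K"
    using K by (simp add: simplicial_complex_def)
  moreover have "compact S" if "S \<in> K" for S
    using simplicial_complex_simplex[OF K that] compact_simplex by metis
  ultimately have "bounded (\<Union>K)"
    by (intro bounded_Union) (auto simp: compact_imp_bounded)
  then obtain R where R: "\<And>x. x \<in> \<Union>K \<Longrightarrow> norm x \<le> R"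
    by (auto simp: bounded_iff)
  \<comment> \<open>The margin 2h lets the net be dense around every point within 2h of K, which
    \<open>coverK\<close> and \<open>radius\<close> need.\<close>
  define B where "B = cball (0::'a) (R + 2 * h)"
  have "compact B" "0 < 2 * h"
    using h(1) by (auto simp: B_def)
  then obtain A where A: "finite A" "A \<subseteq> B" "\<And>x y. \<lbrakk>x \<in> A; y \<in> A \<union> Z; x \<noteq> y\<rbrakk> \<Longrightarrow> 2 * h \<le> dist x y"
    "\<And>z. z \<in> B \<Longrightarrow> \<exists>x\<in>Z \<union> A. dist x z < 2 * h"
    using maximal_separated_net[of B "2 * h" Z] by metis
  define X where "X = Z \<union> A"
  have X: "finite X"
    using A(1) shell_points_finite[OF sep h] by (simp add: X_def Z_def)
  have near: "\<exists>x\<in>X. dist x z < 2 * h" if "y \<in> \<Union>K" "dist y z \<le> 2 * h" for y z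
  proof -
    have "norm z \<le> norm y + dist y z"
      by (metis dist_0_norm dist_triangle)
    then have "z \<in> B"
      using R[OF that(1)] that(2) by (simp add: B_def)
    then show ?thesis
      using A(4) by (simp add: X_def)
  qed
  have close: "x \<in> Z \<and> y \<in> Z" if "x \<in> X" "y \<in> X" "x \<noteq> y" "dist x y < 2 * h" for x y
    using A(3)[of x y] A(3)[of y x] that by (force simp: X_def dist_commute)
  obtain D where D: "simplicial_complex D"
    and cells: "\<And>S. S \<in> D \<Longrightarrow> \<exists>Y\<subseteq>X. \<not> affine_dependent Y \<and> S = convex hull Y \<and>
           (card Y = DIM('a) + 1 \<longrightarrow> (\<exists>c r. (\<forall>y\<in>Y. dist c y = r) \<and> (\<forall>x\<in>X. r \<le> dist c x)))"
    and strict: "\<And>Y c r. \<lbrakk>Y \<subseteq> X; \<not> affine_dependent Y; 0 \<le> r; \<And>y. y \<in> Y \<Longrightarrow> dist c y = r;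
           \<And>x. x \<in> X - Y \<Longrightarrow> r < dist c x\<rbrakk> \<Longrightarrow> convex hull Y \<in> D"
    and cover: "\<And>y. (\<And>q. q \<noteq> 0 \<Longrightarrow> \<exists>x\<in>X. q \<bullet> x < q \<bullet> y) \<Longrightarrow> y \<in> \<Union>D"
    using delaunay_triangulation[OF X] by blast
  \<comment> \<open>Some net point is closer than 2h to the point 2h behind \<open>y\<close> in a
    given direction, hence itself behind \<open>y\<close>: \<open>y\<close> is interior to the hull
    of X.\<close>
  have coverK: "y \<in> \<Union>D" if y: "y \<in> \<Union>K" for y
  proof (rule cover)
    fix q :: 'a assume "q \<noteq> 0"
    define z where "z = y - (2 * h) *\<^sub>R sgn q"
    have "dist y z \<le> 2 * h"
      using h(1) \<open>q \<noteq> 0\<close> by (simp add: z_def dist_norm norm_sgn)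
    then obtain x where x: "x \<in> X" "dist x z < 2 * h"
      using near[OF y] by blast
    have "q \<bullet> x - q \<bullet> z \<le> norm q * norm (x - z)"
      using norm_cauchy_schwarz[of q "x - z"] by (simp add: inner_diff_right)
    also have "\<dots> < norm q * (2 * h)"
      using x \<open>q \<noteq> 0\<close> by (simp add: dist_norm)
    also have "\<dots> = q \<bullet> y - q \<bullet> z"
      using \<open>q \<noteq> 0\<close> by (simp add: z_def inner_diff_right sgn_div_norm power2_eq_square flip: power2_norm_eq_inner)
    finally have "q \<bullet> x < q \<bullet> y"
      by simp
    then show "\<exists>x\<in>X. q \<bullet> x < q \<bullet> y"
      using x(1) by blast
  qed
  have edge_cell: "\<exists>S\<in>D. z \<in> S \<and> S \<subseteq> closed_segment v m"
    if vm: "(v, m) \<in> half_edges K" and z: "z \<in> closed_segment v m" for v m z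
  proof -
    obtain a b where ab: "a \<in> Z" "b \<in> Z" "a \<noteq> b" "dist a b < 2 * h" "z \<in> closed_segment a b"
      "closed_segment a b \<subseteq> closed_segment v m"
      "\<And>x. x \<in> Z - {a, b} \<Longrightarrow> dist a b / 2 < dist (midpoint a b) x"
      using shell_points_gabriel[OF sep h vm z] unfolding Z_def by metis
    have "convex hull {a, b} \<in> D"
    proof (rule strict[of _ "dist a b / 2" "midpoint a b"])
      show "{a, b} \<subseteq> X"
        using ab by (auto simp: X_def)
      show "\<not> affine_dependent {a, b}"
        by (rule affine_independent_2)
      show "dist (midpoint a b) y = dist a b / 2" if "y \<in> {a, b}" for y
        using that by (auto simp: dist_midpoint)
      fix x assume x: "x \<in> X - {a, b}"
      show "dist a b / 2 < dist (midpoint a b) x"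
      proof (cases "x \<in> Z")
        case False
        then have "2 * h \<le> dist x a"
          using A(3)[of x a] x ab by (auto simp: X_def)
        also have "\<dots> \<le> dist (midpoint a b) x + dist (midpoint a b) a"
          by (metis add.commute dist_commute dist_triangle)
        finally show ?thesis
          using ab(4) by (simp add: dist_midpoint)
      qed (use ab x in auto)
    qed simp
    then show ?thesis
      using ab by (metis segment_convex_hull)
  qed
  \<comment> \<open>These cells fill the vertices and edges of K and so form the walls that stop
    other cells in \<open>interior_cell\<close>.\<close>
  have low_cell: "\<exists>S\<in>D. z \<in> S \<and> S \<subseteq> T" if T: "T \<in> K" "aff_dim T \<le> 1" and z: "z \<in> T" for T z
  proof -
    obtain C n where C: "\<not> affine_dependent C" "int (card C) = n + 1" "T = convex hull C" "n simplex T"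
      using simplicial_complex_simplex[OF K T(1)] unfolding simplex_def by metis
    have "aff_dim T = n"
      using C(4) aff_dim_simplex by blast
    then have "card C \<le> 2" "C \<noteq> {}"
      using C T z by auto
    then have "card C = 1 \<or> card C = 2"
      using aff_independent_finite[OF C(1)] by (auto simp: le_Suc_eq numeral_2_eq_2)
    then show ?thesis
    proof
      assume "card C = 1"
      then obtain v where v: "C = {v}"
        by (auto simp: card_1_singleton_iff)
      then have Tv: "T = {v}" using C by simp
      then have "v \<in> X"
        using T by (auto simp: X_def Z_def shell_points_def)
      then have "convex hull {v} \<in> D"
        by (intro strict[of _ 0 v]) auto
      then show ?thesis
        using z Tv by auto
    next
      assume "card C = 2"
      then obtain v w where vw: "C = {v, w}" "v \<noteq> w"
        by (auto simp: card_2_iff)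
      then have Tvw: "T = closed_segment v w"
        using C by (simp add: segment_convex_hull)
      define m where "m = midpoint v w"
      have "(v, m) \<in> half_edges K" "(w, m) \<in> half_edges K"
        using T Tvw vw by (auto simp: half_edges_def m_def midpoint_sym closed_segment_commute)
      moreover have "closed_segment v m \<subseteq> T" "closed_segment w m \<subseteq> T"
        by (auto simp: Tvw m_def subset_closed_segment)
      moreover have "z \<in> closed_segment v m \<or> z \<in> closed_segment w m"
        using Un_closed_segment[of m v w] z by (auto simp: Tvw m_def closed_segment_commute)
      ultimately show ?thesis
        using edge_cell by (meson order_trans)
    qed
  qed
  have dim_le: "aff_dim S \<le> 2" for S :: "'a set"
    using aff_dim_le_DIM[of S] dim by simp
  \<comment> \<open>A cell leaving T would cross a facet at a point of some wall cell. Its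
    intersection with the wall is a face that meets the open segment from \<open>y\<close> to the
    outside, so it contains \<open>y\<close>, which is interior to T.\<close>
  have interior_cell: "S \<subseteq> T"
    if T: "T \<in> K" "aff_dim T = 2" and S: "S \<in> D" and y: "y \<in> S" "y \<in> interior T" for S T y
  proof (rule ccontr)
    assume "\<not> S \<subseteq> T"
    then obtain z where z: "z \<in> S" "z \<notin> T" by blast
    note front = two_simplex_frontier[OF dim K T]
    obtain w where w: "w \<in> closed_segment y z" "w \<in> frontier T"
      using connected_Int_frontier[of "closed_segment y z" T] z y interior_subset[of T] by auto
    obtain F where F: "F facet_of T" "w \<in> F"
      using w front(1,2) by auto
    obtain S' where S': "S' \<in> D" "w \<in> S'" "S' \<subseteq> F"
      using low_cell[of F w] front(3)[OF F(1)] F(2) by auto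
    have "w \<in> open_segment y z"
      using w z y front(2) by (auto simp: open_segment_def)
    moreover have "S \<inter> S' face_of S"
      using D S S' by (intro simplicial_complex_Int_face)
    moreover have "S = convex hull S"
      using simplicial_complex_simplex[OF D S] by (metis convex_simplex hull_same)
    then have "w \<in> S"
      using w y z by (metis convex_convex_hull convex_contains_segment subsetD)
    ultimately have "y \<in> S'"
      using face_ofD[of "S \<inter> S'" S w y z] y z S' by blast
    then show False
      using S' F front(1) y(2) by blast
  qed
  define M where "M = {S \<in> D. \<exists>T\<in>K. S \<subseteq> T}"
  \<comment> \<open>All vertices and edges are kept, so M' is closed under faces and omits only
    triangles with a side shorter than 2h.\<close>
  define M' where "M' = {S \<in> M. aff_dim S \<le> 1 \<or>
    (\<exists>Y\<subseteq>X. \<not> affine_dependent Y \<and> S = convex hull Y \<and>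
       (\<exists>c r. (\<forall>y\<in>Y. dist c y = r) \<and> (\<forall>x\<in>X. r \<le> dist c x)) \<and>
       (\<forall>x\<in>Y. \<forall>y\<in>Y. x \<noteq> y \<longrightarrow> 2 * h \<le> dist x y))}"
  have "simplicial_complex M"
  proof (rule simplicial_complex_subset[OF D])
    fix S F assume "S \<in> M" "F face_of S"
    then show "F \<in> M"
      using simplicial_complex_face[OF D] face_of_imp_subset[of F S] unfolding M_def by blast
  qed (auto simp: M_def)
  have MK: "\<Union>M = \<Union>K"
  proof
    show "\<Union>K \<subseteq> \<Union>M"
    proof
      fix y assume y: "y \<in> \<Union>K"
      then obtain T where T: "T \<in> K" "y \<in> T" by blast
      consider "aff_dim T \<le> 1" | "aff_dim T = 2" "y \<in> interior T" | "aff_dim T = 2" "y \<notin> interior T"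
        using dim_le[of T] by linarith
      then show "y \<in> \<Union>M"
      proof cases
        case 1
        then show ?thesis
          using low_cell[of T y] T by (auto simp: M_def)
      next
        case 2
        obtain S where "S \<in> D" "y \<in> S"
          using coverK[OF y] by blast
        then show ?thesis
          using interior_cell[OF T(1) 2(1) _ _ 2(2)] T(1) by (auto simp: M_def)
      next
        case 3
        then obtain F where F: "F facet_of T" "y \<in> F"
          using two_simplex_frontier(1)[OF dim K T(1)] T(2) by auto
        then show ?thesis
          using low_cell[of F y] two_simplex_frontier(3)[OF dim K T(1) 3(1) F(1)] by (auto simp: M_def)
      qed
    qed
  qed (auto simp: M_def)
  have sub: "subdivision_of M K"
    using \<open>simplicial_complex M\<close> MK by (auto simp: subdivision_of_def M_def)
  have "simplicial_complex M'"
  proof (rule simplicial_complex_subset[OF \<open>simplicial_complex M\<close>])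
    fix S F assume S: "S \<in> M'" and F: "F face_of S"
    have "F \<in> M"
      using S F simplicial_complex_face[OF \<open>simplicial_complex M\<close>] unfolding M'_def by blast
    moreover have "aff_dim F \<le> 1" if "F \<noteq> S"
    proof -
      have "convex S"
        using S simplicial_complex_simplex[OF \<open>simplicial_complex M\<close>, of S] convex_simplex by (auto simp: M'_def)
      then have "aff_dim F < aff_dim S"
        using face_of_aff_dim_lt F that by blast
      then show ?thesis
        using dim_le[of S] by simp
    qed
    ultimately show "F \<in> M'"
      using S by (cases "F = S") (auto simp: M'_def)
  qed (auto simp: M'_def)
  then have sub': "subcomplex_of M' M"
    by (auto simp: subcomplex_of_def M'_def)
  have Z_skel: "Z \<subseteq> \<Union>(skeleton 1 K)"
  proof -
    have "closed_segment v m \<subseteq> \<Union>(skeleton 1 K)" if "(v, m) \<in> half_edges K" for v m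
    proof -
      obtain w where w: "v \<noteq> w" "closed_segment v w \<in> K" "m = midpoint v w"
        using \<open>(v, m) \<in> half_edges K\<close> by (auto simp: half_edges_def)
      moreover have "aff_dim (closed_segment v w) = 1"
        using w by (metis aff_dim_simplex one_simplex_segment)
      ultimately show ?thesis
        using half_segment(1)[OF w(1)] by (auto simp: skeleton_def)
    qed
    moreover have "{v. {v} \<in> K} \<subseteq> \<Union>(skeleton 1 K)"
      by (force simp: skeleton_def)
    ultimately show ?thesis
      using shell_points_subset[OF sep h] unfolding Z_def by blast
  qed
  \<comment> \<open>The circumcentre may lie far from K, where nothing is known of the net. The net
    is used instead at distance 2h from a vertex towards the centre: for larger r, a net point
    closer than 2h to that place is strictly inside the sphere.\<close>
  have radius: "r \<le> 2 * h"
    if S: "S \<in> M" "S = convex hull Y" "Y \<noteq> {}" and sphere: "\<forall>y\<in>Y. dist z y = r" "\<forall>x\<in>X. r \<le> dist z x"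
    for S Y z r
  proof (rule ccontr)
    assume r: "\<not> r \<le> 2 * h"
    obtain y where y: "y \<in> Y" using S by blast
    have "y \<in> \<Union>K"
      using S(1,2) hull_inc[OF y, of convex] MK by blast
    define p where "p = y + (2 * h / r) *\<^sub>R (z - y)"
    have nzy: "norm (z - y) = r"
      using sphere(1) y by (simp add: dist_norm)
    have rpos: "0 < r" using r h by simp
    have "dist y p = 2 * h"
      using nzy rpos h by (simp add: p_def dist_norm)
    then obtain x where x: "x \<in> X" "dist x p < 2 * h"
      using near[OF \<open>y \<in> \<Union>K\<close>, of p] by auto
    have "z - p = (1 - 2 * h / r) *\<^sub>R (z - y)"
      by (simp add: p_def algebra_simps)
    then have "dist z p = \<bar>1 - 2 * h / r\<bar> * r"
      using nzy by (simp add: dist_norm)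
    also have "\<dots> = r - 2 * h"
      using r rpos by (simp add: abs_if field_simps)
    finally have "dist z x < r"
      using x(2) dist_triangle[of z x p] by (simp add: dist_commute)
    then show False
      using sphere(2) x(1) by force
  qed
  have triangle: "\<exists>Y\<subseteq>X. \<not> affine_dependent Y \<and> card Y = 3 \<and> S = convex hull Y \<and>
      (\<exists>c r. (\<forall>y\<in>Y. dist c y = r) \<and> (\<forall>x\<in>X. r \<le> dist c x))"
    if S: "S \<in> M" "aff_dim S = 2" for S
  proof -
    obtain Y where Y: "Y \<subseteq> X" "\<not> affine_dependent Y" "S = convex hull Y"
      "card Y = DIM('a) + 1 \<longrightarrow> (\<exists>c r. (\<forall>y\<in>Y. dist c y = r) \<and> (\<forall>x\<in>X. r \<le> dist c x))"
      using cells[of S] S(1) unfolding M_def by blast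
    have "int (card Y) = 3"
      using aff_dim_affine_independent[OF Y(2)] S(2) Y(3) by (simp add: aff_dim_convex_hull)
    then have "card Y = 3" by simp
    then show ?thesis
      using Y dim by auto
  qed
  have quality: "diameter S * perimeter S / half_inball_volume S \<le> disc_ratio_bound \<delta> \<and>
      diameter S / inradius S \<le> inradius_ratio_bound \<delta>"
    if S: "S \<in> M" "1 \<le> aff_dim S" and \<delta>: "0 < \<delta>"
      and fat: "aff_dim S = 2 \<Longrightarrow> \<exists>Y\<subseteq>X. \<not> affine_dependent Y \<and> card Y = 3 \<and> S = convex hull Y \<and>
        (\<exists>c r. (\<forall>y\<in>Y. dist c y = r) \<and> (\<forall>x\<in>X. r \<le> dist c x)) \<and>
        (\<forall>x\<in>Y. \<forall>y\<in>Y. x \<noteq> y \<longrightarrow> \<delta> * (2 * h) \<le> dist x y)" for S \<delta>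
  proof (cases "aff_dim S = 2")
    case False
    then have "aff_dim S = 1"
      using S(2) dim_le[of S] by simp
    moreover obtain n where "n simplex S"
      using S(1) simplicial_complex_simplex[OF \<open>simplicial_complex M\<close>] by blast
    ultimately show ?thesis
      using simplex_regularity_segment[of n S] by (auto simp: disc_ratio_bound_def inradius_ratio_bound_def)
  next
    case True
    then obtain Y z r where Y: "Y \<subseteq> X" "\<not> affine_dependent Y" "card Y = 3" "S = convex hull Y"
      "\<forall>y\<in>Y. dist z y = r" "\<forall>x\<in>X. r \<le> dist z x"
      "\<forall>x\<in>Y. \<forall>y\<in>Y. x \<noteq> y \<longrightarrow> \<delta> * (2 * h) \<le> dist x y"
      using fat by blast
    then have "Y \<noteq> {}" by auto
    then have "r \<le> 2 * h"
      using radius[OF S(1) Y(4) _ Y(5,6)] by simp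
    then have "diameter S * perimeter S / half_inball_volume S \<le> 27648 / (pi * \<delta> ^ 6)"
      "diameter S / inradius S \<le> 48 / \<delta> ^ 3"
      using simplex_regularity_triangle[OF Y(2,3,4), of "2 * h" \<delta> z r] h(1) \<delta> Y(5,7) by auto
    then show ?thesis
      by (auto simp: disc_ratio_bound_def inradius_ratio_bound_def)
  qed
  have regM: "regularity_constant M \<le> disc_ratio_bound (\<kappa> / 4) + 2 * inradius_ratio_bound (\<kappa> / 4)"
  proof (rule regularity_constant_le)
    fix S assume S: "S \<in> M" "1 \<le> aff_dim S"
    \<comment> \<open>The 4 expresses the separation \<open>\<kappa> * h / 2\<close> of cut points
      as a fraction of the circumradius bound 2h.\<close>
    have sides: "\<kappa> / 4 * (2 * h) \<le> dist x y" if "x \<in> X" "y \<in> X" "x \<noteq> y" for x y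
    proof (cases "dist x y < 2 * h")
      case True
      then show ?thesis
        using close[OF that True] shell_points_separated[OF sep h, of x y] that(3) by (simp add: Z_def)
    next
      case False
      moreover have "\<kappa> / 4 * (2 * h) \<le> 1 * (2 * h)"
        using \<kappa> h by (intro mult_right_mono) auto
      ultimately show ?thesis by simp
    qed
    have Y: "\<exists>Y\<subseteq>X. \<not> affine_dependent Y \<and> card Y = 3 \<and> S = convex hull Y \<and>
        (\<exists>c r. (\<forall>y\<in>Y. dist c y = r) \<and> (\<forall>x\<in>X. r \<le> dist c x)) \<and>
        (\<forall>x\<in>Y. \<forall>y\<in>Y. x \<noteq> y \<longrightarrow> \<kappa> / 4 * (2 * h) \<le> dist x y)" if "aff_dim S = 2"
    proof -
      obtain Y where Y: "Y \<subseteq> X" "\<not> affine_dependent Y" "card Y = 3" "S = convex hull Y"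
        "\<exists>c r. (\<forall>y\<in>Y. dist c y = r) \<and> (\<forall>x\<in>X. r \<le> dist c x)"
        using triangle[OF S(1) \<open>aff_dim S = 2\<close>] by blast
      have "\<forall>x\<in>Y. \<forall>y\<in>Y. x \<noteq> y \<longrightarrow> \<kappa> / 4 * (2 * h) \<le> dist x y"
        using sides Y(1) by blast
      then show ?thesis
        using Y by blast
    qed
    show "diameter S * perimeter S / half_inball_volume S \<le> disc_ratio_bound (\<kappa> / 4)"
      "diameter S / inradius S \<le> inradius_ratio_bound (\<kappa> / 4)"
      using quality[OF S _ Y] \<kappa> by auto
  qed (auto simp: disc_ratio_bound_def inradius_ratio_bound_def)
  have regM': "regularity_constant M' \<le> disc_ratio_bound 1 + 2 * inradius_ratio_bound 1"
  proof (rule regularity_constant_le)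
    fix S assume S: "S \<in> M'" "1 \<le> aff_dim S"
    then have SM: "S \<in> M" by (simp add: M'_def)
    have Y: "\<exists>Y\<subseteq>X. \<not> affine_dependent Y \<and> card Y = 3 \<and> S = convex hull Y \<and>
        (\<exists>c r. (\<forall>y\<in>Y. dist c y = r) \<and> (\<forall>x\<in>X. r \<le> dist c x)) \<and>
        (\<forall>x\<in>Y. \<forall>y\<in>Y. x \<noteq> y \<longrightarrow> 1 * (2 * h) \<le> dist x y)" if S2: "aff_dim S = 2"
    proof -
      obtain Y where Y: "Y \<subseteq> X" "\<not> affine_dependent Y" "S = convex hull Y"
        "\<exists>c r. (\<forall>y\<in>Y. dist c y = r) \<and> (\<forall>x\<in>X. r \<le> dist c x)"
        "\<forall>x\<in>Y. \<forall>y\<in>Y. x \<noteq> y \<longrightarrow> 2 * h \<le> dist x y"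
        using S(1) S2 by (auto simp: M'_def)
      have "int (card Y) = 3"
        using aff_dim_affine_independent[OF Y(2)] S2 Y(3) by (simp add: aff_dim_convex_hull)
      then have "card Y = 3" by simp
      then show ?thesis
        using Y by auto
    qed
    show "diameter S * perimeter S / half_inball_volume S \<le> disc_ratio_bound 1"
      "diameter S / inradius S \<le> inradius_ratio_bound 1"
      using quality[OF SM S(2) _ Y] by auto
  qed (auto simp: disc_ratio_bound_def inradius_ratio_bound_def)
  have nbhd: "\<Union>M - \<Union>M' \<subseteq> {x. \<exists>y\<in>\<Union>(skeleton 1 K). norm (x - y) \<le> 4 * h}"
  proof
    fix x assume x: "x \<in> \<Union>M - \<Union>M'"
    then obtain S where S: "S \<in> M" "x \<in> S" "S \<notin> M'"
      by blast
    then have "aff_dim S = 2"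
      using dim_le[of S] by (auto simp: M'_def)
    then obtain Y z r where Y: "Y \<subseteq> X" "\<not> affine_dependent Y" "card Y = 3" "S = convex hull Y"
      "\<forall>y\<in>Y. dist z y = r" "\<forall>x\<in>X. r \<le> dist z x"
      using triangle[OF S(1)] by blast
    then have "\<not> (\<forall>x\<in>Y. \<forall>y\<in>Y. x \<noteq> y \<longrightarrow> 2 * h \<le> dist x y)"
      using S(1,3) unfolding M'_def by blast
    then obtain a b where ab: "a \<in> Y" "b \<in> Y" "a \<noteq> b" "dist a b < 2 * h"
      by force
    then have "a \<in> \<Union>(skeleton 1 K)"
      using close[of a b] Y(1) Z_skel by blast
    \<comment> \<open>A triangle lies in its circumdisc, so its points are within twice the
      circumradius of the vertex \<open>a\<close>.\<close>
    moreover have "S \<subseteq> cball z r"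
      unfolding Y(4) using Y(5) by (intro hull_minimal convex_cball) auto
    then have "dist z x \<le> r"
      using S(2) by auto
    moreover have "r \<le> 2 * h"
      using radius[OF S(1) Y(4) _ Y(5,6)] ab by blast
    moreover have "dist x a \<le> dist z x + dist z a"
      by (metis dist_commute dist_triangle)
    ultimately show "x \<in> {x. \<exists>y\<in>\<Union>(skeleton 1 K). norm (x - y) \<le> 4 * h}"
      using Y(5) ab(1) by (force simp: dist_norm)
  qed
  show thesis
    by (rule that[OF sub sub' nbhd regM regM'])
qed

lemma Iso_2:
  assumes dim: "DIM('a::euclidean_space) = 2"
  shows "Iso 2 TYPE('a)"
  unfolding Iso_def
proof (rule exI[of _ "disc_ratio_bound 1 + 2 * inradius_ratio_bound 1"], intro allI impI)
  fix K :: "'a set set" assume "simplicial_complex_of_dim 2 K"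
  then have K: "simplicial_complex K"
    by (simp add: simplicial_complex_of_dim_def)
  obtain c \<kappa> where sep: "spokes.separated_by {v. {v} \<in> K} (half_edges K) c \<kappa>"
    using spokes.separated_by_exists[OF spokes_half_edges[OF K]] by blast
  have c: "0 < c"
    using sep by (simp add: spokes.separated_by_def[OF spokes_half_edges[OF K]])
  show "\<exists>\<alpha>. \<forall>\<epsilon>>0. \<exists>M M'. subdivision_of M K \<and> subcomplex_of M' M \<and>
      \<Union>M - \<Union>M' \<subseteq> {x. \<exists>y \<in> \<Union>(skeleton (int 2 - 1) K). norm (x - y) < \<epsilon>} \<and>
      regularity_constant M \<le> \<alpha> \<and>
      regularity_constant M' \<le> disc_ratio_bound 1 + 2 * inradius_ratio_bound 1"
  proof (rule exI[of _ "disc_ratio_bound (\<kappa> / 4) + 2 * inradius_ratio_bound (\<kappa> / 4)"], intro allI impI)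
    fix \<epsilon> :: real assume \<epsilon>: "0 < \<epsilon>"
    \<comment> \<open>The 8 makes 4h at most \<epsilon>/2, which turns the closed bound into a
      strict one. Both \<open>c\<close> and \<open>\<kappa>\<close> were fixed before \<epsilon>, so
      the bound for \<open>M\<close> is independent of it.\<close>
    define h where "h = min (c / 4) (\<epsilon> / 8)"
    have h: "0 < h" "4 * h \<le> c" "4 * h < \<epsilon>"
      using c \<epsilon> by (auto simp: h_def min_def)
    obtain M M' where MM: "subdivision_of M K" "subcomplex_of M' M"
      "\<Union>M - \<Union>M' \<subseteq> {x. \<exists>y\<in>\<Union>(skeleton 1 K). norm (x - y) \<le> 4 * h}"
      "regularity_constant M \<le> disc_ratio_bound (\<kappa> / 4) + 2 * inradius_ratio_bound (\<kappa> / 4)"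
      "regularity_constant M' \<le> disc_ratio_bound 1 + 2 * inradius_ratio_bound 1"
      using subdivision_at_scale[OF dim K sep h(1,2)] by blast
    have "{x. \<exists>y\<in>\<Union>(skeleton 1 K). norm (x - y) \<le> 4 * h} \<subseteq>
        {x. \<exists>y\<in>\<Union>(skeleton 1 K). norm (x - y) < \<epsilon>}"
      using h(3) by (auto intro: le_less_trans)
    then show "\<exists>M M'. subdivision_of M K \<and> subcomplex_of M' M \<and>
      \<Union>M - \<Union>M' \<subseteq> {x. \<exists>y \<in> \<Union>(skeleton (int 2 - 1) K). norm (x - y) < \<epsilon>} \<and>
      regularity_constant M \<le> disc_ratio_bound (\<kappa> / 4) + 2 * inradius_ratio_bound (\<kappa> / 4) \<and>
      regularity_constant M' \<le> disc_ratio_bound 1 + 2 * inradius_ratio_bound 1"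
      using MM by (intro exI[of _ M] exI[of _ M']) auto
  qed
qed

theorem theorem3p5:
  fixes p :: nat
  assumes "(p = 1 \<and> p \<le> CARD('q::finite)) \<or> (p = 2 \<and> CARD('q) = 2)"
  shows "Iso p TYPE(real ^ 'q)"
  using assms Iso_1[where 'a = "real ^ 'q"] Iso_2[where 'a = "real ^ 'q"] by auto

end
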